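(* There exist standard $\sigma$-finite measure spaces $(X,\mu)$, $(Y,\nu)$ and an $\omega$-continuous function $\varphi:X\times Y\to\mathbb{C}$ which is not a closable multiplier and is an extremely non-Schur multiplier.
   Context: Write $H_1=L^2(X,\mu)$, $H_2=L^2(Y,\nu)$; for $k\in L^2(X\times Y,\mu\times\nu)$ let $I_k:H_1\to H_2$ be $(I_k\xi)(y)=\int_X k(x,y)\xi(x)\,d\mu(x)$. For measurable $\varphi:X\times Y\to\mathbb{C}$ let $D(\varphi)=\{k\in L^2(X\times Y):\varphi k\in L^2(X\times Y)\}$ and let $S_\varphi$ be the densely defined operator on the space $\mathcal{K}(H_1,H_2)$ of compact operators (operator norm) with domain $\{I_k:k\in D(\varphi)\}$ given by $S_\varphi(I_k)=I_{\varphi k}$. The function $\varphi$ is a closable multiplier if the norm closure of the graph of $S_\varphi$ is the graph of an operator. A function $\varphi\in L^\infty(X\times Y)$ is a Schur multiplier if there is $C>0$ with $\|I_{\varphi k}\|_{\mathrm{op}}\le C\|I_k\|_{\mathrm{op}}$ for all $k\in L^2(X\times Y)$; the same definition applies on a rectangle with restricted measures. A rectangle is a set $\alpha\times\beta$ with $\alpha\subseteq X$, $\beta\subseteq Y$ measurable. A set is marginally null if it is contained in $(X_0\times Y)\cup(X\times Y_0)$ with $\mu(X_0)=\nu(Y_0)=0$; sets are marginally equivalent if their symmetric difference is marginally null; $E$ marginally contains $F$ if $F\setminus E$ is marginally null. A set is $\omega$-open if it is marginally equivalent to a countable union of rectangles; a measurable function $g:X\times Y\to\mathbb{C}$ is $\omega$-continuous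 if $g^{-1}(U)$ is $\omega$-open for every open $U\subseteq\mathbb{C}$. For a family $\mathcal{E}$ of $\omega$-open sets, its $\omega$-union is the (unique up to marginal equivalence) countable union of elements of $\mathcal{E}$ which marginally contains every element of $\mathcal{E}$. The set $\kappa_\varphi$ is the complement of the $\omega$-union of the family of all rectangles $\alpha\times\beta$ such that $\varphi|_{\alpha\times\beta}$ is a Schur multiplier. The function $\varphi$ is called an extremely non-Schur multiplier if $\kappa_\varphi=X\times Y$ up to marginal equivalence. *)

theory Defs
  imports "HOL-Analysis.Analysis"
begin

section \<open>Standard measure spaces\<close>

definition standard_borel_space :: "'a measure \<Rightarrow> bool" where
  "standard_borel_space M \<longleftrightarrow>
     (\<exists>T. completely_metrizable_space T \<and> second_countable T \<and> topspace T = space M \<and>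
          sets M = sigma_sets (space M) {U. openin T U})"

definition standard_sigma_finite :: "'a measure \<Rightarrow> bool" where
  "standard_sigma_finite M \<longleftrightarrow> standard_borel_space M \<and> sigma_finite_measure M"


section \<open>Square integrable functions and operators between them\<close>

text \<open>
  The elements of $L^2$ are represented by square integrable functions, equality being equality
  almost everywhere. Accordingly an operator from $L^2(M)$ to $L^2(N)$ is represented by a map on
  representatives, and two such maps are the same operator when \<open>op_eq\<close> holds.
\<close>

definition L2 :: "'a measure \<Rightarrow> ('a \<Rightarrow> complex) set" where
  "L2 M = {f \<in> borel_measurable M. integrable M (\<lambda>x. (cmod (f x))\<^sup>2)}"

definition L2_norm :: "'a measure \<Rightarrow> ('a \<Rightarrow> complex) \<Rightarrow> real" where
  "L2_norm M f = sqrt (\<integral>x. (cmod (f x))\<^sup>2 \<partial>M)"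

definition Linfty :: "'a measure \<Rightarrow> ('a \<Rightarrow> complex) set" where
  "Linfty M = {f \<in> borel_measurable M. \<exists>B. AE x in M. cmod (f x) \<le> B}"

type_synonym ('a, 'b) operator = "('a \<Rightarrow> complex) \<Rightarrow> 'b \<Rightarrow> complex"

definition op_eq :: "'a measure \<Rightarrow> 'b measure \<Rightarrow> ('a, 'b) operator \<Rightarrow> ('a, 'b) operator \<Rightarrow> bool" where
  "op_eq M N S T \<longleftrightarrow> (\<forall>\<xi>\<in>L2 M. AE y in N. S \<xi> y = T \<xi> y)"

definition op_diff :: "('a, 'b) operator \<Rightarrow> ('a, 'b) operator \<Rightarrow> ('a, 'b) operator" where
  "op_diff S T = (\<lambda>\<xi> y. S \<xi> y - T \<xi> y)"

text \<open>The supremum is meaningful for bounded operators only; it is applied to no others.\<close>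

definition op_norm :: "'a measure \<Rightarrow> 'b measure \<Rightarrow> ('a, 'b) operator \<Rightarrow> real" where
  "op_norm M N T = (SUP \<xi>\<in>{\<xi> \<in> L2 M. L2_norm M \<xi> \<le> 1}. L2_norm N (T \<xi>))"

definition linear_operator :: "'a measure \<Rightarrow> 'b measure \<Rightarrow> ('a, 'b) operator \<Rightarrow> bool" where
  "linear_operator M N T \<longleftrightarrow>
     (\<forall>\<xi>\<in>L2 M. T \<xi> \<in> L2 N) \<and>
     (\<forall>\<xi>\<in>L2 M. \<forall>\<eta>\<in>L2 M. (AE x in M. \<xi> x = \<eta> x) \<longrightarrow> (AE y in N. T \<xi> y = T \<eta> y)) \<and>
     (\<forall>\<xi>\<in>L2 M. \<forall>\<eta>\<in>L2 M. AE y in N. T (\<lambda>x. \<xi> x + \<eta> x) y = T \<xi> y + T \<eta> y) \<and>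
     (\<forall>c. \<forall>\<xi>\<in>L2 M. AE y in N. T (\<lambda>x. c * \<xi> x) y = c * T \<xi> y)"

definition compact_operator :: "'a measure \<Rightarrow> 'b measure \<Rightarrow> ('a, 'b) operator \<Rightarrow> bool" where
  "compact_operator M N T \<longleftrightarrow>
     linear_operator M N T \<and>
     (\<forall>\<xi>::nat \<Rightarrow> 'a \<Rightarrow> complex. (\<forall>n. \<xi> n \<in> L2 M \<and> L2_norm M (\<xi> n) \<le> 1) \<longrightarrow>
        (\<exists>r \<eta>. strict_mono r \<and> \<eta> \<in> L2 N \<and>
               (\<lambda>n. L2_norm N (\<lambda>y. T (\<xi> (r n)) y - \<eta> y)) \<longlonglongrightarrow> 0))"

definition integral_operator :: "'a measure \<Rightarrow> ('a \<times> 'b \<Rightarrow> complex) \<Rightarrow> ('a, 'b) operator" where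
  "integral_operator M k = (\<lambda>\<xi> y. \<integral>x. k (x, y) * \<xi> x \<partial>M)"


section \<open>Closable multipliers and Schur multipliers\<close>

definition mult_domain :: "'a measure \<Rightarrow> 'b measure \<Rightarrow> ('a \<times> 'b \<Rightarrow> complex) \<Rightarrow> ('a \<times> 'b \<Rightarrow> complex) set" where
  "mult_domain M N \<phi> = {k \<in> L2 (M \<Otimes>\<^sub>M N). (\<lambda>p. \<phi> p * k p) \<in> L2 (M \<Otimes>\<^sub>M N)}"

definition mult_graph ::
  "'a measure \<Rightarrow> 'b measure \<Rightarrow> ('a \<times> 'b \<Rightarrow> complex) \<Rightarrow> (('a, 'b) operator \<times> ('a, 'b) operator) set" where
  "mult_graph M N \<phi> =
     {(integral_operator M k, integral_operator M (\<lambda>p. \<phi> p * k p)) | k. k \<in> mult_domain M N \<phi>}"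

text \<open>The closure is taken in $K \times K$, where $K$ is the space of compact operators.\<close>

definition graph_closure ::
  "'a measure \<Rightarrow> 'b measure \<Rightarrow> (('a, 'b) operator \<times> ('a, 'b) operator) set
     \<Rightarrow> (('a, 'b) operator \<times> ('a, 'b) operator) set" where
  "graph_closure M N G =
     {(T, S). compact_operator M N T \<and> compact_operator M N S \<and>
        (\<forall>\<epsilon>>0. \<exists>(A, B)\<in>G. op_norm M N (op_diff T A) < \<epsilon> \<and> op_norm M N (op_diff S B) < \<epsilon>)}"

definition is_operator_graph ::
  "'a measure \<Rightarrow> 'b measure \<Rightarrow> (('a, 'b) operator \<times> ('a, 'b) operator) set \<Rightarrow> bool" where
  "is_operator_graph M N G \<longleftrightarrow>
     (\<forall>(T, S)\<in>G. \<forall>(T', S')\<in>G. op_eq M N T T' \<longrightarrow> op_eq M N S S')"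

definition closable_multiplier :: "'a measure \<Rightarrow> 'b measure \<Rightarrow> ('a \<times> 'b \<Rightarrow> complex) \<Rightarrow> bool" where
  "closable_multiplier M N \<phi> \<longleftrightarrow> is_operator_graph M N (graph_closure M N (mult_graph M N \<phi>))"

definition schur_multiplier :: "'a measure \<Rightarrow> 'b measure \<Rightarrow> ('a \<times> 'b \<Rightarrow> complex) \<Rightarrow> bool" where
  "schur_multiplier M N \<phi> \<longleftrightarrow>
     \<phi> \<in> Linfty (M \<Otimes>\<^sub>M N) \<and>
     (\<exists>C>0. \<forall>k\<in>L2 (M \<Otimes>\<^sub>M N).
        op_norm M N (integral_operator M (\<lambda>p. \<phi> p * k p)) \<le> C * op_norm M N (integral_operator M k))"

definition schur_multiplier_on ::
  "'a measure \<Rightarrow> 'b measure \<Rightarrow> ('a \<times> 'b \<Rightarrow> complex) \<Rightarrow> 'a set \<Rightarrow> 'b set \<Rightarrow> bool" where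
  "schur_multiplier_on M N \<phi> \<alpha> \<beta> \<longleftrightarrow> schur_multiplier (restrict_space M \<alpha>) (restrict_space N \<beta>) \<phi>"


section \<open>The marginal pseudo-topology\<close>

definition rectangles :: "'a measure \<Rightarrow> 'b measure \<Rightarrow> ('a \<times> 'b) set set" where
  "rectangles M N = {\<alpha> \<times> \<beta> | \<alpha> \<beta>. \<alpha> \<in> sets M \<and> \<beta> \<in> sets N}"

definition marginally_null :: "'a measure \<Rightarrow> 'b measure \<Rightarrow> ('a \<times> 'b) set \<Rightarrow> bool" where
  "marginally_null M N E \<longleftrightarrow>
     (\<exists>X0\<in>null_sets M. \<exists>Y0\<in>null_sets N. E \<subseteq> X0 \<times> space N \<union> space M \<times> Y0)"

definition marginally_equivalent ::
  "'a measure \<Rightarrow> 'b measure \<Rightarrow> ('a \<times> 'b) set \<Rightarrow> ('a \<times> 'b) set \<Rightarrow> bool" where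
  "marginally_equivalent M N E F \<longleftrightarrow> marginally_null M N ((E - F) \<union> (F - E))"

definition marginally_contains ::
  "'a measure \<Rightarrow> 'b measure \<Rightarrow> ('a \<times> 'b) set \<Rightarrow> ('a \<times> 'b) set \<Rightarrow> bool" where
  "marginally_contains M N E F \<longleftrightarrow> marginally_null M N (F - E)"

definition omega_open :: "'a measure \<Rightarrow> 'b measure \<Rightarrow> ('a \<times> 'b) set \<Rightarrow> bool" where
  "omega_open M N E \<longleftrightarrow>
     (\<exists>\<R>. countable \<R> \<and> \<R> \<subseteq> rectangles M N \<and> marginally_equivalent M N E (\<Union>\<R>))"

definition omega_continuous :: "'a measure \<Rightarrow> 'b measure \<Rightarrow> ('a \<times> 'b \<Rightarrow> complex) \<Rightarrow> bool" where
  "omega_continuous M N g \<longleftrightarrow>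
     g \<in> borel_measurable (M \<Otimes>\<^sub>M N) \<and>
     (\<forall>U. open U \<longrightarrow> omega_open M N (g -` U \<inter> (space M \<times> space N)))"

definition is_omega_union ::
  "'a measure \<Rightarrow> 'b measure \<Rightarrow> ('a \<times> 'b) set set \<Rightarrow> ('a \<times> 'b) set \<Rightarrow> bool" where
  "is_omega_union M N \<E> U \<longleftrightarrow>
     (\<exists>\<F>. countable \<F> \<and> \<F> \<subseteq> \<E> \<and> U = \<Union>\<F>) \<and> (\<forall>E\<in>\<E>. marginally_contains M N U E)"

lemma marginally_null_subset:
  "marginally_null M N F \<Longrightarrow> E \<subseteq> F \<Longrightarrow> marginally_null M N E"
  unfolding marginally_null_def by blast

lemma marginally_null_UN:
  assumes "countable I" and "\<And>i. i \<in> I \<Longrightarrow> marginally_null M N (E i)"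
  shows "marginally_null M N (\<Union>i\<in>I. E i)"
proof -
  have "\<forall>i\<in>I. \<exists>A B. A \<in> null_sets M \<and> B \<in> null_sets N \<and>
          E i \<subseteq> A \<times> space N \<union> space M \<times> B"
    using assms(2) unfolding marginally_null_def by blast
  then obtain A B where AB: "\<And>i. i \<in> I \<Longrightarrow> A i \<in> null_sets M \<and> B i \<in> null_sets N \<and>
          E i \<subseteq> A i \<times> space N \<union> space M \<times> B i"
    by metis
  have "(\<Union>i\<in>I. A i) \<in> null_sets M" "(\<Union>i\<in>I. B i) \<in> null_sets N"
    using AB assms(1) by (auto intro!: null_sets_UN')
  moreover have "(\<Union>i\<in>I. E i) \<subseteq> (\<Union>i\<in>I. A i) \<times> space N \<union> space M \<times> (\<Union>i\<in>I. B i)"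
    using AB by blast
  ultimately show ?thesis
    unfolding marginally_null_def by blast
qed

lemma omega_union_unique:
  assumes U: "is_omega_union M N \<E> U" and V: "is_omega_union M N \<E> V"
  shows "marginally_equivalent M N U V"
proof -
  have *: "marginally_null M N (P - Q)"
    if P: "is_omega_union M N \<E> P" and Q: "is_omega_union M N \<E> Q" for P Q
  proof -
    obtain \<F> where F: "countable \<F>" "\<F> \<subseteq> \<E>" "P = \<Union>\<F>"
      using P unfolding is_omega_union_def by blast
    have "marginally_null M N (\<Union>E\<in>\<F>. E - Q)"
      using F Q unfolding is_omega_union_def marginally_contains_def
      by (intro marginally_null_UN) auto
    then show ?thesis
      by (rule marginally_null_subset) (use F in blast)
  qed
  have "marginally_null M N (\<Union>b\<in>UNIV. if b then U - V else V - U)"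
    by (intro marginally_null_UN) (use *[OF U V] *[OF V U] in auto)
  then show ?thesis
    unfolding marginally_equivalent_def by (rule marginally_null_subset) (auto split: if_splits)
qed

text \<open>
  By the preceding lemma the choice made here does not matter, up to marginal equivalence.
\<close>

definition omega_union :: "'a measure \<Rightarrow> 'b measure \<Rightarrow> ('a \<times> 'b) set set \<Rightarrow> ('a \<times> 'b) set" where
  "omega_union M N \<E> = (SOME U. is_omega_union M N \<E> U)"

definition kappa :: "'a measure \<Rightarrow> 'b measure \<Rightarrow> ('a \<times> 'b \<Rightarrow> complex) \<Rightarrow> ('a \<times> 'b) set" where
  "kappa M N \<phi> =
     space M \<times> space N -
     omega_union M N {\<alpha> \<times> \<beta> | \<alpha> \<beta>. \<alpha> \<in> sets M \<and> \<beta> \<in> sets N \<and> schur_multiplier_on M N \<phi> \<alpha> \<beta>}"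

definition extremely_non_schur :: "'a measure \<Rightarrow> 'b measure \<Rightarrow> ('a \<times> 'b \<Rightarrow> complex) \<Rightarrow> bool" where
  "extremely_non_schur M N \<phi> \<longleftrightarrow>
     marginally_equivalent M N (kappa M N \<phi>) (space M \<times> space N)"

end

theory Submission
  imports Defs "HOL-Probability.Probability"
begin

text \<open>
  Both measures are the standard Gaussian measure on the line, and the multiplier is
  \<open>\<phi> (x, y) = (\<Sum>j. exp (\<i> N\<^sub>j x y) / j!)\<close> with frequencies \<open>N\<^sub>j\<close> that grow very fast. The operator with
  kernel \<open>exp (\<i> t x y)\<close> is essentially a dilated Fourier transform; although its kernel has modulus
  one everywhere, its norm tends to zero as \<open>\<bar>t\<bar>\<close> tends to infinity (\<open>wave_op_bound_vanishes\<close>).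

  Let \<open>k\<^sub>n (x, y) = n! exp (- \<i> N\<^sub>n x y)\<close>. If \<open>N\<^sub>n\<close> is large enough, the operators of the kernels \<open>k\<^sub>n\<close>
  tend to zero. In the product \<open>\<phi> k\<^sub>n\<close> the \<open>n\<close>-th term of the series becomes the constant \<open>1\<close>. The terms
  with \<open>j < n\<close> become waves of frequency \<open>N\<^sub>j - N\<^sub>n\<close>, whose operators are small if \<open>N\<^sub>n\<close> was chosen
  large in terms of its predecessors. The terms with \<open>j > n\<close> add up to at most \<open>e / (n + 1)\<close> in the
  supremum norm. So the operators of \<open>\<phi> k\<^sub>n\<close> converge to the operator of the constant kernel \<open>1\<close>
  (\<open>collapsing_wave_series\<close>), which is compact and not zero. Hence the closure of the graph is not the
  graph of an operator (\<open>not_closable_multiplier\<close>).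

  The same kernels work on every rectangle \<open>\<alpha> \<times> \<beta>\<close> of positive measure: restriction does not increase
  norms, and the constant kernel \<open>1\<close> still gives a nonzero operator there. So \<open>\<phi>\<close> is not a Schur
  multiplier on any such rectangle (\<open>not_schur_multiplier_on\<close>), the rectangles on which it is one are
  marginally null, and so is their \<open>\<omega>\<close>-union (\<open>extremely_non_schurI\<close>). Finally \<open>\<phi>\<close> is continuous as a
  uniform limit of continuous functions, which gives \<open>\<omega>\<close>-continuity.
\<close>

section \<open>Square integrable functions\<close>

lemma L2_norm_nonneg: "0 \<le> L2_norm M f"
  unfolding L2_norm_def by simp

lemma L2_norm_power2: "(L2_norm M f)\<^sup>2 = (\<integral>x. (cmod (f x))\<^sup>2 \<partial>M)"
  unfolding L2_norm_def by simp

lemma L2_norm_cong: "(\<And>x. x \<in> space M \<Longrightarrow> f x = g x) \<Longrightarrow> L2_norm M f = L2_norm M g"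
  unfolding L2_norm_def by (simp cong: Bochner_Integration.integral_cong)

lemma L2_measurable [measurable_dest]: "f \<in> L2 M \<Longrightarrow> f \<in> borel_measurable M"
  unfolding L2_def by simp

lemma L2_integrable_power2: "f \<in> L2 M \<Longrightarrow> integrable M (\<lambda>x. (cmod (f x))\<^sup>2)"
  unfolding L2_def by simp

lemma zero_in_L2: "(\<lambda>_. 0) \<in> L2 M"
  unfolding L2_def by simp

lemma L2_norm_scale: "L2_norm M (\<lambda>x. c * f x) = cmod c * L2_norm M f"
  unfolding L2_norm_def by (simp add: norm_mult power_mult_distrib real_sqrt_mult)

lemma L2_cauchy_schwarz:
  assumes f: "f \<in> L2 M" and g: "g \<in> L2 M"
  shows "integrable M (\<lambda>x. cmod (f x) * cmod (g x))"
    and "(\<integral>x. cmod (f x) * cmod (g x) \<partial>M) \<le> L2_norm M f * L2_norm M g"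
proof -
  have [measurable]: "f \<in> borel_measurable M" "g \<in> borel_measurable M"
    using f g by auto
  have bd: "(cmod (f x) * cmod (g x)) \<le> (cmod (f x))\<^sup>2 + (cmod (g x))\<^sup>2" for x
    using sum_squares_bound[of "cmod (f x)" "cmod (g x)"]
      mult_nonneg_nonneg[OF norm_ge_zero[of "f x"] norm_ge_zero[of "g x"]]
    by linarith
  show int: "integrable M (\<lambda>x. cmod (f x) * cmod (g x))"
    by (rule Bochner_Integration.integrable_bound
        [OF Bochner_Integration.integrable_add[OF L2_integrable_power2[OF f] L2_integrable_power2[OF g]]])
      (use bd in auto)
  let ?I = "\<integral>x. cmod (f x) * cmod (g x) \<partial>M"
  have I0: "0 \<le> ?I"
    by simp
  have "(ennreal ?I)\<^sup>2 = (\<integral>\<^sup>+x. ennreal (cmod (f x)) * ennreal (cmod (g x)) \<partial>M)\<^sup>2"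
    using nn_integral_eq_integral[OF int] by (simp add: ennreal_mult)
  also have "\<dots> \<le> (\<integral>\<^sup>+x. (ennreal (cmod (f x)))\<^sup>2 \<partial>M) * (\<integral>\<^sup>+x. (ennreal (cmod (g x)))\<^sup>2 \<partial>M)"
    by (rule Cauchy_Schwarz_nn_integral) auto
  also have "\<dots> = ennreal ((L2_norm M f)\<^sup>2) * ennreal ((L2_norm M g)\<^sup>2)"
    using nn_integral_eq_integral[OF L2_integrable_power2[OF f]]
      nn_integral_eq_integral[OF L2_integrable_power2[OF g]]
    by (simp add: ennreal_power L2_norm_power2)
  finally have "ennreal (?I\<^sup>2) \<le> ennreal ((L2_norm M f * L2_norm M g)\<^sup>2)"
    using I0 by (simp add: ennreal_power power_mult_distrib ennreal_mult)
  then have "?I\<^sup>2 \<le> (L2_norm M f * L2_norm M g)\<^sup>2"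
    by (simp add: ennreal_le_iff)
  then show "?I \<le> L2_norm M f * L2_norm M g"
    by (rule power2_le_imp_le) (simp add: L2_norm_nonneg)
qed

lemma L2_add:
  assumes f: "f \<in> L2 M" and g: "g \<in> L2 M"
  shows "(\<lambda>x. f x + g x) \<in> L2 M"
    and "L2_norm M (\<lambda>x. f x + g x) \<le> L2_norm M f + L2_norm M g"
proof -
  have [measurable]: "f \<in> borel_measurable M" "g \<in> borel_measurable M"
    using f g by auto
  let ?h = "\<lambda>x. (cmod (f x))\<^sup>2 + (cmod (g x))\<^sup>2 + 2 * (cmod (f x) * cmod (g x))"
  have int: "integrable M ?h"
    using L2_integrable_power2[OF f] L2_integrable_power2[OF g] L2_cauchy_schwarz(1)[OF f g] by simp
  have bd: "(cmod (f x + g x))\<^sup>2 \<le> ?h x" for x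
    using power_mono[OF norm_triangle_ineq[of "f x" "g x"], of 2] by (simp add: power2_sum)
  have int': "integrable M (\<lambda>x. (cmod (f x + g x))\<^sup>2)"
    by (rule Bochner_Integration.integrable_bound[OF int]) (use bd in \<open>auto simp: abs_of_nonneg\<close>)
  then show "(\<lambda>x. f x + g x) \<in> L2 M"
    unfolding L2_def by simp
  have "(L2_norm M (\<lambda>x. f x + g x))\<^sup>2 \<le> (\<integral>x. ?h x \<partial>M)"
    unfolding L2_norm_power2 by (rule integral_mono[OF int' int bd])
  also have "\<dots> = (L2_norm M f)\<^sup>2 + (L2_norm M g)\<^sup>2 + 2 * (\<integral>x. cmod (f x) * cmod (g x) \<partial>M)"
    using L2_integrable_power2[OF f] L2_integrable_power2[OF g] L2_cauchy_schwarz(1)[OF f g]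
    by (simp add: L2_norm_power2)
  also have "\<dots> \<le> (L2_norm M f + L2_norm M g)\<^sup>2"
    using L2_cauchy_schwarz(2)[OF f g] by (simp add: power2_sum)
  finally show "L2_norm M (\<lambda>x. f x + g x) \<le> L2_norm M f + L2_norm M g"
    by (rule power2_le_imp_le) (simp add: L2_norm_nonneg)
qed

lemma (in finite_measure) bounded_in_L2:
  assumes [measurable]: "f \<in> borel_measurable M" and B: "\<And>x. x \<in> space M \<Longrightarrow> cmod (f x) \<le> B"
  shows "f \<in> L2 M"
proof -
  have "integrable M (\<lambda>x. (cmod (f x))\<^sup>2)"
    by (rule integrable_const_bound[where B = "B\<^sup>2"]) (use B in \<open>auto intro!: AE_I2 power_mono\<close>)
  then show ?thesis
    unfolding L2_def by simp
qed

lemma (in prob_space) L2_norm_const: "L2_norm M (\<lambda>_. c) = cmod c"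
  unfolding L2_norm_def by (simp add: prob_space)

lemma (in prob_space) L2_norm_le_sup:
  assumes f: "f \<in> borel_measurable M" and B: "\<And>x. x \<in> space M \<Longrightarrow> cmod (f x) \<le> B"
  shows "L2_norm M f \<le> B"
proof -
  obtain x where x: "x \<in> space M"
    using not_empty by blast
  have B0: "0 \<le> B"
    using B[OF x] norm_ge_zero order_trans by blast
  have "(L2_norm M f)\<^sup>2 \<le> (\<integral>x. B\<^sup>2 \<partial>M)"
    unfolding L2_norm_power2
    by (rule integral_mono) (use bounded_in_L2[OF f B] B in \<open>auto intro!: power_mono L2_integrable_power2\<close>)
  then show ?thesis
    using B0 by (auto simp: prob_space intro: power2_le_imp_le)
qed

lemma (in prob_space) L2_imp_integrable:
  assumes f: "f \<in> L2 M"
  shows "integrable M f" and "(\<integral>x. cmod (f x) \<partial>M) \<le> L2_norm M f"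
proof -
  have one: "(\<lambda>_. 1) \<in> L2 M"
    by (rule bounded_in_L2[where B = 1]) auto
  have "integrable M (\<lambda>x. cmod (f x))"
    using L2_cauchy_schwarz(1)[OF f one] by simp
  then show "integrable M f"
    using f by (subst (asm) integrable_norm_iff) auto
  show "(\<integral>x. cmod (f x) \<partial>M) \<le> L2_norm M f"
    using L2_cauchy_schwarz(2)[OF f one] by (simp add: L2_norm_const)
qed


section \<open>Integral operators with bounded kernels\<close>

text \<open>
  Over a finite measure a bounded kernel can be integrated against a square integrable function on
  every section, so no exceptional null sets have to be carried along.
\<close>

definition bounded_kernel :: "'a measure \<Rightarrow> 'b measure \<Rightarrow> ('a \<times> 'b \<Rightarrow> complex) \<Rightarrow> bool" where
  "bounded_kernel M N k \<longleftrightarrow> k \<in> borel_measurable (M \<Otimes>\<^sub>M N) \<and> (\<exists>B. \<forall>p. cmod (k p) \<le> B)"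

text \<open>
  An explicit bound replaces the supremum \<^const>\<open>op_norm\<close>: such bounds can be added and restricted
  without any discussion of whether a supremum is finite.
\<close>

definition op_bound :: "'a measure \<Rightarrow> 'b measure \<Rightarrow> ('a \<times> 'b \<Rightarrow> complex) \<Rightarrow> real \<Rightarrow> bool" where
  "op_bound M N k c \<longleftrightarrow>
     (\<forall>\<xi>\<in>L2 M. L2_norm N (integral_operator M k \<xi>) \<le> c * L2_norm M \<xi>)"

lemma op_boundD: "op_bound M N k c \<Longrightarrow> \<xi> \<in> L2 M \<Longrightarrow> L2_norm N (integral_operator M k \<xi>) \<le> c * L2_norm M \<xi>"
  unfolding op_bound_def by blast

lemma op_bound_mono:
  assumes "op_bound M N k c" and "c \<le> d"
  shows "op_bound M N k d"
  unfolding op_bound_def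
proof
  fix \<xi> assume "\<xi> \<in> L2 M"
  with assms(1) have "L2_norm N (integral_operator M k \<xi>) \<le> c * L2_norm M \<xi>"
    by (rule op_boundD)
  also have "\<dots> \<le> d * L2_norm M \<xi>"
    by (rule mult_right_mono[OF assms(2) L2_norm_nonneg])
  finally show "L2_norm N (integral_operator M k \<xi>) \<le> d * L2_norm M \<xi>" .
qed

lemma bounded_kernelI:
  "k \<in> borel_measurable (M \<Otimes>\<^sub>M N) \<Longrightarrow> (\<And>p. cmod (k p) \<le> B) \<Longrightarrow> bounded_kernel M N k"
  unfolding bounded_kernel_def by blast

lemma bounded_kernelE:
  assumes "bounded_kernel M N k"
  obtains B where "k \<in> borel_measurable (M \<Otimes>\<^sub>M N)" and "\<And>p. cmod (k p) \<le> B"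
  using assms unfolding bounded_kernel_def by blast

lemma bounded_kernel_const: "bounded_kernel M N (\<lambda>_. c)"
  by (rule bounded_kernelI[OF borel_measurable_const order_refl])

lemma bounded_kernel_add:
  assumes k: "bounded_kernel M N k" and l: "bounded_kernel M N l"
  shows "bounded_kernel M N (\<lambda>p. k p + l p)"
proof -
  obtain B where [measurable]: "k \<in> borel_measurable (M \<Otimes>\<^sub>M N)" and B: "\<And>p. cmod (k p) \<le> B"
    using bounded_kernelE[OF k] by blast
  obtain C where [measurable]: "l \<in> borel_measurable (M \<Otimes>\<^sub>M N)" and C: "\<And>p. cmod (l p) \<le> C"
    using bounded_kernelE[OF l] by blast
  show ?thesis
    by (rule bounded_kernelI[OF _ order_trans[OF norm_triangle_ineq add_mono[OF B C]]]) measurable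
qed

lemma bounded_kernel_mult:
  assumes k: "bounded_kernel M N k" and l: "bounded_kernel M N l"
  shows "bounded_kernel M N (\<lambda>p. k p * l p)"
proof -
  obtain B where [measurable]: "k \<in> borel_measurable (M \<Otimes>\<^sub>M N)" and B: "\<And>p. cmod (k p) \<le> B"
    using bounded_kernelE[OF k] by blast
  obtain C where [measurable]: "l \<in> borel_measurable (M \<Otimes>\<^sub>M N)" and C: "\<And>p. cmod (l p) \<le> C"
    using bounded_kernelE[OF l] by blast
  have "0 \<le> B"
    using B norm_ge_zero order_trans by blast
  then have "cmod (k p * l p) \<le> B * C" for p
    unfolding norm_mult by (rule mult_mono[OF B C _ norm_ge_zero])
  then show ?thesis
    by (rule bounded_kernelI[rotated]) measurable
qed

lemma bounded_kernel_sum: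
  "(\<And>i. i \<in> I \<Longrightarrow> bounded_kernel M N (k i)) \<Longrightarrow> bounded_kernel M N (\<lambda>p. \<Sum>i\<in>I. k i p)"
proof (induction I rule: infinite_finite_induct)
  case (insert i I)
  then have "bounded_kernel M N (\<lambda>p. k i p + (\<Sum>i\<in>I. k i p))"
    by (intro bounded_kernel_add) auto
  then show ?case
    using insert.hyps by simp
qed (simp_all add: bounded_kernel_const)

context pair_prob_space
begin

lemma bounded_kernel_section_integrable:
  assumes k: "bounded_kernel M1 M2 k" and \<xi>: "\<xi> \<in> L2 M1" and y: "y \<in> space M2"
  shows "integrable M1 (\<lambda>x. k (x, y) * \<xi> x)"
proof -
  have [measurable]: "k \<in> borel_measurable (M1 \<Otimes>\<^sub>M M2)" "\<xi> \<in> borel_measurable M1"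
    using k \<xi> unfolding bounded_kernel_def by auto
  obtain B where B: "\<And>p. cmod (k p) \<le> B"
    using k unfolding bounded_kernel_def by blast
  have [measurable]: "(\<lambda>x. k (x, y)) \<in> borel_measurable M1"
    using y by measurable
  have bd: "cmod (k (x, y) * \<xi> x) \<le> norm (B * cmod (\<xi> x))" for x
    unfolding norm_mult using B[of "(x, y)"]
    by (simp add: abs_mult mult_right_mono abs_if)
  have int: "integrable M1 (\<lambda>x. B * cmod (\<xi> x))"
    using M1.L2_imp_integrable(1)[OF \<xi>] by simp
  have meas: "(\<lambda>x. k (x, y) * \<xi> x) \<in> borel_measurable M1"
    by measurable
  show ?thesis
    by (rule Bochner_Integration.integrable_bound[OF int meas AE_I2[OF bd]])
qed

lemma integral_operator_sup_bound:
  assumes k: "k \<in> borel_measurable (M1 \<Otimes>\<^sub>M M2)" and B: "\<And>p. cmod (k p) \<le> B"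
    and \<xi>: "\<xi> \<in> L2 M1" and y: "y \<in> space M2"
  shows "cmod (integral_operator M1 k \<xi> y) \<le> B * L2_norm M1 \<xi>"
proof -
  have bk: "bounded_kernel M1 M2 k"
    using k B unfolding bounded_kernel_def by blast
  have B0: "0 \<le> B"
    using B norm_ge_zero order_trans by blast
  have "cmod (integral_operator M1 k \<xi> y) \<le> (\<integral>x. cmod (k (x, y) * \<xi> x) \<partial>M1)"
    unfolding integral_operator_def by (rule integral_norm_bound)
  also have "\<dots> \<le> (\<integral>x. B * cmod (\<xi> x) \<partial>M1)"
    using B by (intro integral_mono integrable_norm integrable_mult_right
        bounded_kernel_section_integrable[OF bk \<xi> y] M1.L2_imp_integrable(1)[OF \<xi>])
      (simp add: norm_mult mult_right_mono)
  also have "\<dots> \<le> B * L2_norm M1 \<xi>"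
    using M1.L2_imp_integrable(2)[OF \<xi>] B0 by (simp add: mult_left_mono)
  finally show ?thesis .
qed

lemma integral_operator_measurable:
  assumes k [measurable]: "k \<in> borel_measurable (M1 \<Otimes>\<^sub>M M2)" and \<xi>: "\<xi> \<in> L2 M1"
  shows "integral_operator M1 k \<xi> \<in> borel_measurable M2"
proof -
  have [measurable]: "\<xi> \<in> borel_measurable M1"
    using \<xi> by auto
  show ?thesis
    unfolding integral_operator_def by measurable
qed

lemma integral_operator_in_L2:
  assumes k: "bounded_kernel M1 M2 k" and \<xi>: "\<xi> \<in> L2 M1"
  shows "integral_operator M1 k \<xi> \<in> L2 M2"
proof -
  obtain B where B: "\<And>p. cmod (k p) \<le> B" and km: "k \<in> borel_measurable (M1 \<Otimes>\<^sub>M M2)"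
    using k unfolding bounded_kernel_def by blast
  show ?thesis
    by (rule M2.bounded_in_L2[OF integral_operator_measurable[OF km \<xi>] integral_operator_sup_bound[OF km B \<xi>]])
qed

lemma op_bound_sup:
  assumes k: "k \<in> borel_measurable (M1 \<Otimes>\<^sub>M M2)" and B: "\<And>p. cmod (k p) \<le> B"
  shows "op_bound M1 M2 k B"
  unfolding op_bound_def
  by (intro ballI M2.L2_norm_le_sup integral_operator_measurable[OF k] integral_operator_sup_bound[OF k B])

lemma op_bound_add:
  assumes k: "bounded_kernel M1 M2 k" "op_bound M1 M2 k c"
    and l: "bounded_kernel M1 M2 l" "op_bound M1 M2 l d"
  shows "op_bound M1 M2 (\<lambda>p. k p + l p) (c + d)"
  unfolding op_bound_def
proof
  fix \<xi> assume \<xi>: "\<xi> \<in> L2 M1"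
  have "integral_operator M1 (\<lambda>p. k p + l p) \<xi> y = integral_operator M1 k \<xi> y + integral_operator M1 l \<xi> y"
    if "y \<in> space M2" for y
    unfolding integral_operator_def
    using bounded_kernel_section_integrable[OF k(1) \<xi> that]
      bounded_kernel_section_integrable[OF l(1) \<xi> that]
    by (simp add: distrib_right)
  then have "L2_norm M2 (integral_operator M1 (\<lambda>p. k p + l p) \<xi>)
      = L2_norm M2 (\<lambda>y. integral_operator M1 k \<xi> y + integral_operator M1 l \<xi> y)"
    by (rule L2_norm_cong)
  also have "\<dots> \<le> c * L2_norm M1 \<xi> + d * L2_norm M1 \<xi>"
    using L2_add(2)[OF integral_operator_in_L2[OF k(1) \<xi>] integral_operator_in_L2[OF l(1) \<xi>]]
      op_boundD[OF k(2) \<xi>] op_boundD[OF l(2) \<xi>] by linarith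
  finally show "L2_norm M2 (integral_operator M1 (\<lambda>p. k p + l p) \<xi>) \<le> (c + d) * L2_norm M1 \<xi>"
    by (simp add: distrib_right)
qed

lemma op_bound_sum:
  assumes "finite I" and "\<And>i. i \<in> I \<Longrightarrow> bounded_kernel M1 M2 (k i)"
    and "\<And>i. i \<in> I \<Longrightarrow> op_bound M1 M2 (k i) (c i)"
  shows "op_bound M1 M2 (\<lambda>p. \<Sum>i\<in>I. k i p) (\<Sum>i\<in>I. c i)"
  using assms
proof (induction I rule: finite_induct)
  case empty
  have "op_bound M1 M2 (\<lambda>_. 0) 0"
    by (rule op_bound_sup) auto
  then show ?case by simp
next
  case (insert i I)
  have "op_bound M1 M2 (\<lambda>p. k i p + (\<Sum>i\<in>I. k i p)) (c i + (\<Sum>i\<in>I. c i))"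
    by (intro op_bound_add bounded_kernel_sum insert) auto
  then show ?case
    using insert.hyps by simp
qed

lemma bounded_kernel_in_L2:
  assumes "bounded_kernel M1 M2 k"
  shows "k \<in> L2 (M1 \<Otimes>\<^sub>M M2)"
proof -
  obtain B where "\<And>p. cmod (k p) \<le> B" "k \<in> borel_measurable (M1 \<Otimes>\<^sub>M M2)"
    using assms unfolding bounded_kernel_def by blast
  then show ?thesis
    by (intro P.bounded_in_L2[where B = B])
qed

end

lemma op_bound_scale:
  assumes "op_bound M N k c"
  shows "op_bound M N (\<lambda>p. a * k p) (cmod a * c)"
proof -
  have eq: "integral_operator M (\<lambda>p. a * k p) \<xi> = (\<lambda>y. a * integral_operator M k \<xi> y)" for \<xi>
    unfolding integral_operator_def mult.assoc by (rule ext) (rule integral_mult_right_zero)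
  show ?thesis
    unfolding op_bound_def eq L2_norm_scale mult.assoc
    using assms by (auto dest: op_boundD intro: mult_left_mono)
qed

lemma op_norm_le:
  assumes "\<And>\<xi>. \<xi> \<in> L2 M \<Longrightarrow> L2_norm N (T \<xi>) \<le> c * L2_norm M \<xi>" and "0 \<le> c"
  shows "op_norm M N T \<le> c"
  unfolding op_norm_def
proof (rule cSUP_least)
  show "{\<xi> \<in> L2 M. L2_norm M \<xi> \<le> 1} \<noteq> {}"
  proof -
    have "(\<lambda>_. 0) \<in> {\<xi> \<in> L2 M. L2_norm M \<xi> \<le> 1}"
      by (simp add: zero_in_L2 L2_norm_def)
    then show ?thesis by blast
  qed
next
  fix \<xi> assume "\<xi> \<in> {\<xi> \<in> L2 M. L2_norm M \<xi> \<le> 1}"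
  then show "L2_norm N (T \<xi>) \<le> c"
    using assms(1)[of \<xi>] mult_left_mono[of "L2_norm M \<xi>" 1 c] assms(2) by auto
qed

lemma op_norm_integral_operator_le:
  "op_bound M N k c \<Longrightarrow> 0 \<le> c \<Longrightarrow> op_norm M N (integral_operator M k) \<le> c"
  by (rule op_norm_le) (auto dest: op_boundD)

section \<open>Restriction to rectangles\<close>

text \<open>
  A function on a part of the space is identified with its extension by zero.
\<close>

lemma L2_restrict_space_iff:
  assumes "\<alpha> \<in> sets M"
  shows "f \<in> L2 (restrict_space M \<alpha>) \<longleftrightarrow> (\<lambda>x. indicator \<alpha> x *\<^sub>R f x) \<in> L2 M"
proof -
  have a: "\<alpha> \<inter> space M \<in> sets M"
    using assms by auto
  have eq: "(cmod (indicator \<alpha> x *\<^sub>R f x))\<^sup>2 = indicator \<alpha> x *\<^sub>R (cmod (f x))\<^sup>2" for x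
    by (simp split: split_indicator)
  show ?thesis
    unfolding L2_def mem_Collect_eq eq borel_measurable_restrict_space_iff[OF a]
      integrable_restrict_space[OF a] ..
qed

lemma L2_norm_restrict_space:
  assumes "\<alpha> \<in> sets M"
  shows "L2_norm (restrict_space M \<alpha>) f = L2_norm M (\<lambda>x. indicator \<alpha> x *\<^sub>R f x)"
proof -
  have a: "\<alpha> \<inter> space M \<in> sets M"
    using assms by auto
  have eq: "(cmod (indicator \<alpha> x *\<^sub>R f x))\<^sup>2 = indicator \<alpha> x *\<^sub>R (cmod (f x))\<^sup>2" for x
    by (simp split: split_indicator)
  show ?thesis
    unfolding L2_norm_def eq integral_restrict_space[OF a] ..
qed

lemma L2_restrict_space:
  assumes f: "f \<in> L2 M" and \<alpha> [measurable]: "\<alpha> \<in> sets M"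
  shows "f \<in> L2 (restrict_space M \<alpha>)" and "L2_norm (restrict_space M \<alpha>) f \<le> L2_norm M f"
proof -
  have fm [measurable]: "f \<in> borel_measurable M"
    using f by auto
  have le: "(cmod (indicator \<alpha> x *\<^sub>R f x))\<^sup>2 \<le> (cmod (f x))\<^sup>2" for x
    by (simp split: split_indicator)
  have meas: "(\<lambda>x. indicator \<alpha> x *\<^sub>R f x) \<in> borel_measurable M"
    by measurable
  have int: "integrable M (\<lambda>x. (cmod (indicator \<alpha> x *\<^sub>R f x))\<^sup>2)"
    by (rule Bochner_Integration.integrable_bound[OF L2_integrable_power2[OF f]]) (use le in auto)
  then show "f \<in> L2 (restrict_space M \<alpha>)"
    unfolding L2_restrict_space_iff[OF \<alpha>] using meas by (simp add: L2_def)
  show "L2_norm (restrict_space M \<alpha>) f \<le> L2_norm M f"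
    unfolding L2_norm_restrict_space[OF \<alpha>]
    unfolding L2_norm_def
    by (intro real_sqrt_le_mono integral_mono int L2_integrable_power2[OF f] le)
qed

lemma integral_operator_restrict_space:
  assumes "\<alpha> \<in> sets M"
  shows "integral_operator (restrict_space M \<alpha>) k \<xi> = integral_operator M k (\<lambda>x. indicator \<alpha> x *\<^sub>R \<xi> x)"
proof -
  have a: "\<alpha> \<inter> space M \<in> sets M"
    using assms by auto
  show ?thesis
    unfolding integral_operator_def integral_restrict_space[OF a] by simp
qed

lemma L2_norm_restrict_const:
  assumes \<alpha>: "\<alpha> \<in> sets M"
  shows "L2_norm (restrict_space M \<alpha>) (\<lambda>_. c) = cmod c * sqrt (measure M \<alpha>)"
proof -
  have "\<alpha> \<subseteq> space M"
    using \<alpha> by (rule sets.sets_into_space)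
  then show ?thesis
    using \<alpha> unfolding L2_norm_def
    by (simp add: measure_restrict_space space_restrict_space Int_absorb2 real_sqrt_mult)
qed

context pair_prob_space
begin

lemma integral_operator_restrict_in_L2:
  assumes \<alpha>: "\<alpha> \<in> sets M1" and \<beta>: "\<beta> \<in> sets M2" and k: "bounded_kernel M1 M2 k"
    and \<xi>: "\<xi> \<in> L2 (restrict_space M1 \<alpha>)"
  shows "integral_operator (restrict_space M1 \<alpha>) k \<xi> \<in> L2 (restrict_space M2 \<beta>)"
  using \<xi> unfolding integral_operator_restrict_space[OF \<alpha>] L2_restrict_space_iff[OF \<alpha>]
  by (intro L2_restrict_space(1)[OF _ \<beta>] integral_operator_in_L2[OF k])

text \<open>
  Restricting a kernel to a rectangle composes its operator with an extension by zero on one side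
  and a restriction on the other, both of norm at most one.
\<close>

lemma op_bound_restrict:
  assumes \<alpha>: "\<alpha> \<in> sets M1" and \<beta>: "\<beta> \<in> sets M2"
    and k: "bounded_kernel M1 M2 k" "op_bound M1 M2 k c"
  shows "op_bound (restrict_space M1 \<alpha>) (restrict_space M2 \<beta>) k c"
  unfolding op_bound_def
proof
  fix \<xi> assume "\<xi> \<in> L2 (restrict_space M1 \<alpha>)"
  then have \<xi>: "(\<lambda>x. indicator \<alpha> x *\<^sub>R \<xi> x) \<in> L2 M1"
    unfolding L2_restrict_space_iff[OF \<alpha>] .
  show "L2_norm (restrict_space M2 \<beta>) (integral_operator (restrict_space M1 \<alpha>) k \<xi>)
      \<le> c * L2_norm (restrict_space M1 \<alpha>) \<xi>"
    unfolding integral_operator_restrict_space[OF \<alpha>] L2_norm_restrict_space[OF \<alpha>]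
    using L2_restrict_space(2)[OF integral_operator_in_L2[OF k(1) \<xi>] \<beta>] op_boundD[OF k(2) \<xi>]
    by linarith
qed

lemma bounded_kernel_restrict_in_L2:
  assumes \<alpha>: "\<alpha> \<in> sets M1" and \<beta>: "\<beta> \<in> sets M2" and k: "bounded_kernel M1 M2 k"
  shows "k \<in> L2 (restrict_space M1 \<alpha> \<Otimes>\<^sub>M restrict_space M2 \<beta>)"
proof -
  obtain B where km: "k \<in> borel_measurable (M1 \<Otimes>\<^sub>M M2)" and B: "\<And>p. cmod (k p) \<le> B"
    using bounded_kernelE[OF k] by blast
  let ?R = "restrict_space M1 \<alpha> \<Otimes>\<^sub>M restrict_space M2 \<beta>"
  interpret R: finite_measure ?R
    by (intro finite_measure_pair_measure finite_measure_restrict_space \<alpha> \<beta>) unfold_locales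
  have "(\<lambda>p. (fst p, snd p)) \<in> ?R \<rightarrow>\<^sub>M M1 \<Otimes>\<^sub>M M2"
    by (intro measurable_Pair measurable_compose[OF measurable_fst] measurable_compose[OF measurable_snd]
        measurable_restrict_space1 measurable_ident_sets refl)
  from measurable_compose[OF this km] have "k \<in> borel_measurable ?R"
    by simp
  then show ?thesis
    using B by (rule R.bounded_in_L2)
qed

end

lemma op_norm_ge:
  assumes k: "op_bound M N k c" and "0 \<le> c" and \<xi>: "\<xi> \<in> L2 M" "L2_norm M \<xi> \<le> 1"
  shows "L2_norm N (integral_operator M k \<xi>) \<le> op_norm M N (integral_operator M k)"
  unfolding op_norm_def
proof (rule cSUP_upper)
  show "bdd_above ((\<lambda>\<xi>. L2_norm N (integral_operator M k \<xi>)) ` {\<xi> \<in> L2 M. L2_norm M \<xi> \<le> 1})"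
  proof (rule bdd_aboveI2)
    fix \<eta> assume "\<eta> \<in> {\<xi> \<in> L2 M. L2_norm M \<xi> \<le> 1}"
    then show "L2_norm N (integral_operator M k \<eta>) \<le> c"
      using op_boundD[OF k, of \<eta>] mult_left_mono[of "L2_norm M \<eta>" 1 c] \<open>0 \<le> c\<close> by auto
  qed
qed (use \<xi> in auto)

section \<open>Kernels collapsing onto the constant kernel\<close>

text \<open>
  This is the mechanism behind both negative properties of the multiplier: the operators of the
  kernels \<open>k n\<close> tend to zero, whereas multiplication by \<open>\<phi>\<close> turns them into operators tending to
  that of the constant kernel \<open>1\<close>, which does not vanish on any rectangle of positive measure.
\<close>

locale collapsing_kernels = pair_prob_space M1 M2
  for M1 :: "'a measure" and M2 :: "'b measure" +
  fixes \<phi> :: "'a \<times> 'b \<Rightarrow> complex" and k :: "nat \<Rightarrow> 'a \<times> 'b \<Rightarrow> complex" and a b :: "nat \<Rightarrow> real"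
  assumes k: "\<And>n. bounded_kernel M1 M2 (k n)"
    and \<phi>k: "\<And>n. bounded_kernel M1 M2 (\<lambda>p. \<phi> p * k n p)"
    and a: "\<And>n. op_bound M1 M2 (k n) (a n)" "a \<longlonglongrightarrow> 0"
    and b: "\<And>n. op_bound M1 M2 (\<lambda>p. 1 - \<phi> p * k n p) (b n)" "b \<longlonglongrightarrow> 0"
begin

lemma op_bound_nonneg:
  assumes "op_bound M1 M2 l c"
  shows "0 \<le> c"
proof -
  have "(\<lambda>_. 1) \<in> L2 M1"
    by (rule M1.bounded_in_L2[where B = 1]) auto
  from op_boundD[OF assms this] L2_norm_nonneg[of M2 "integral_operator M1 l (\<lambda>_. 1)"]
  show ?thesis
    by (simp add: M1.L2_norm_const)
qed

lemma one_minus_bounded: "bounded_kernel M1 M2 (\<lambda>p. 1 - \<phi> p * k n p)"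
  using bounded_kernel_add[OF bounded_kernel_const[of M1 M2 1]
      bounded_kernel_mult[OF bounded_kernel_const[of M1 M2 "-1"] \<phi>k[of n]]] by simp

text \<open>
  The operators are tested on the constant function \<open>1\<close>. A Schur multiplier with constant \<open>C\<close> on the
  rectangle would force the image of \<open>1\<close> under the operator of \<open>\<phi> k\<^sub>n\<close> to have norm at most
  \<open>C * a n\<close>, but this image differs by at most \<open>b n\<close> from the constant \<open>measure M1 \<alpha>\<close>.
\<close>

lemma not_schur_multiplier_on:
  assumes \<alpha>: "\<alpha> \<in> sets M1" "measure M1 \<alpha> > 0" and \<beta>: "\<beta> \<in> sets M2" "measure M2 \<beta> > 0"
  shows "\<not> schur_multiplier_on M1 M2 \<phi> \<alpha> \<beta>"
proof
  let ?M = "restrict_space M1 \<alpha>" and ?N = "restrict_space M2 \<beta>"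
  let ?one = "\<lambda>_. 1 :: complex"
  assume "schur_multiplier_on M1 M2 \<phi> \<alpha> \<beta>"
  then obtain C where C: "0 < C" "\<And>l. l \<in> L2 (?M \<Otimes>\<^sub>M ?N) \<Longrightarrow>
      op_norm ?M ?N (integral_operator ?M (\<lambda>p. \<phi> p * l p)) \<le> C * op_norm ?M ?N (integral_operator ?M l)"
    unfolding schur_multiplier_on_def schur_multiplier_def by blast
  have "?one \<in> L2 M1"
    by (rule M1.bounded_in_L2[where B = 1]) auto
  then have one: "?one \<in> L2 ?M"
    by (rule L2_restrict_space(1)[OF _ \<alpha>(1)])
  have one_norm: "L2_norm ?M ?one \<le> 1"
    using M1.prob_le_1[of \<alpha>] by (simp add: L2_norm_restrict_const[OF \<alpha>(1)])
  have one': "(\<lambda>x. indicator \<alpha> x *\<^sub>R ?one x) \<in> L2 M1"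
    using one unfolding L2_restrict_space_iff[OF \<alpha>(1)] .
  let ?c = "measure M1 \<alpha> * sqrt (measure M2 \<beta>)"
  have "?c \<le> C * a n + b n" for n
  proof -
    let ?S = "integral_operator ?M (\<lambda>p. \<phi> p * k n p) ?one"
    let ?D = "integral_operator ?M (\<lambda>p. 1 - \<phi> p * k n p) ?one"
    have split: "?S y + ?D y = of_real (measure M1 \<alpha>)" if "y \<in> space ?N" for y
    proof -
      have y: "y \<in> space M2"
        using that by (simp add: space_restrict_space)
      have "?S y + ?D y = (\<integral>x. \<phi> (x, y) * k n (x, y) * (indicator \<alpha> x *\<^sub>R ?one x)
          + (1 - \<phi> (x, y) * k n (x, y)) * (indicator \<alpha> x *\<^sub>R ?one x) \<partial>M1)"
        unfolding integral_operator_restrict_space[OF \<alpha>(1)]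
        unfolding integral_operator_def
        by (rule Bochner_Integration.integral_add[symmetric])
          (rule bounded_kernel_section_integrable[OF _ one' y, of "\<lambda>p. \<phi> p * k n p"]
              bounded_kernel_section_integrable[OF _ one' y, of "\<lambda>p. 1 - \<phi> p * k n p"],
            rule \<phi>k one_minus_bounded)+
      also have "\<dots> = (\<integral>x. of_real (indicator \<alpha> x) \<partial>M1)"
        by (rule Bochner_Integration.integral_cong) (auto simp: algebra_simps split: split_indicator)
      also have "\<dots> = of_real (measure M1 \<alpha>)"
        using \<alpha>(1) sets.sets_into_space[OF \<alpha>(1)] by (simp add: Int_absorb2)
      finally show ?thesis .
    qed
    obtain B where "(\<lambda>p. \<phi> p * k n p) \<in> borel_measurable (M1 \<Otimes>\<^sub>M M2)" "\<And>p. cmod (\<phi> p * k n p) \<le> B"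
      using bounded_kernelE[OF \<phi>k[of n]] by blast
    then have B: "op_bound M1 M2 (\<lambda>p. \<phi> p * k n p) B"
      by (rule op_bound_sup)
    have S: "L2_norm ?N ?S \<le> C * a n"
    proof -
      have "L2_norm ?N ?S \<le> op_norm ?M ?N (integral_operator ?M (\<lambda>p. \<phi> p * k n p))"
        by (rule op_norm_ge[OF op_bound_restrict[OF \<alpha>(1) \<beta>(1) \<phi>k B] op_bound_nonneg[OF B] one one_norm])
      also have "\<dots> \<le> C * op_norm ?M ?N (integral_operator ?M (k n))"
        by (rule C(2)[OF bounded_kernel_restrict_in_L2[OF \<alpha>(1) \<beta>(1) k]])
      also have "\<dots> \<le> C * a n"
        using C(1) op_norm_integral_operator_le[OF op_bound_restrict[OF \<alpha>(1) \<beta>(1) k a(1)]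
            op_bound_nonneg[OF a(1)]] by simp
      finally show ?thesis .
    qed
    have "L2_norm ?N ?D \<le> b n * L2_norm ?M ?one"
      by (rule op_boundD[OF op_bound_restrict[OF \<alpha>(1) \<beta>(1) one_minus_bounded b(1)] one])
    also have "\<dots> \<le> b n"
      using mult_left_mono[OF one_norm op_bound_nonneg[OF b(1)]] by simp
    finally have D: "L2_norm ?N ?D \<le> b n" .
    have "?c = L2_norm ?N (\<lambda>_. of_real (measure M1 \<alpha>))"
      by (simp add: L2_norm_restrict_const[OF \<beta>(1)])
    also have "\<dots> = L2_norm ?N (\<lambda>y. ?S y + ?D y)"
      using split by (intro L2_norm_cong) simp
    also have "\<dots> \<le> L2_norm ?N ?S + L2_norm ?N ?D"
      by (intro L2_add(2) integral_operator_restrict_in_L2[OF \<alpha>(1) \<beta>(1) _ one] \<phi>k one_minus_bounded)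
    finally show ?thesis
      using S D by linarith
  qed
  moreover have "(\<lambda>n. C * a n + b n) \<longlonglongrightarrow> C * 0 + 0"
    by (intro tendsto_intros a b)
  ultimately have "?c \<le> 0"
    by (intro LIMSEQ_le_const[of "\<lambda>n. C * a n + b n"]) auto
  then show False
    using \<alpha>(2) \<beta>(2) by (simp add: mult_le_0_iff)
qed

text \<open>
  The operator has rank one, so compactness is the Bolzano-Weierstrass theorem for the integrals
  of the given functions.
\<close>

lemma compact_operator_one: "compact_operator M1 M2 (integral_operator M1 (\<lambda>_. 1))"
proof -
  let ?T = "integral_operator M1 (\<lambda>_. 1) :: ('a, 'b) operator"
  have T: "?T \<xi> = (\<lambda>_. \<integral>x. \<xi> x \<partial>M1)" for \<xi>
    unfolding integral_operator_def by simp
  have const: "(\<lambda>_. c) \<in> L2 M2" for c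
    by (rule M2.bounded_in_L2[where B = "cmod c"]) auto
  have "linear_operator M1 M2 ?T"
    unfolding linear_operator_def T
    by (auto intro!: const AE_I2 integral_cong_AE simp: M1.L2_imp_integrable L2_measurable)
  moreover have "\<exists>r \<eta>. strict_mono r \<and> \<eta> \<in> L2 M2 \<and>
      (\<lambda>n. L2_norm M2 (\<lambda>y. ?T (\<xi> (r n)) y - \<eta> y)) \<longlonglongrightarrow> 0"
    if \<xi>: "\<And>n::nat. \<xi> n \<in> L2 M1 \<and> L2_norm M1 (\<xi> n) \<le> 1" for \<xi>
  proof -
    let ?i = "\<lambda>n. \<integral>x. \<xi> n x \<partial>M1"
    have "cmod (?i n) \<le> 1" for n
      using integral_norm_bound[of M1 "\<xi> n"] M1.L2_imp_integrable(2)[of "\<xi> n"] \<xi>[of n] by linarith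
    then have "bounded (range ?i)"
      unfolding bounded_iff by blast
    then obtain l r where lr: "strict_mono (r :: nat \<Rightarrow> nat)" "(?i \<circ> r) \<longlonglongrightarrow> l"
      using bounded_imp_convergent_subsequence by blast
    have "(\<lambda>n. cmod (?i (r n) - l)) \<longlonglongrightarrow> 0"
      using lr(2) by (simp add: comp_def tendsto_norm_zero LIM_zero)
    then show ?thesis
      using lr(1) const by (intro exI[of _ r] exI[of _ "\<lambda>_. l"]) (simp add: T M2.L2_norm_const)
  qed
  ultimately show ?thesis
    unfolding compact_operator_def by blast
qed

lemma compact_operator_zero: "compact_operator M1 M2 (\<lambda>_ _. 0)"
  unfolding compact_operator_def
proof (intro conjI allI impI)
  show "linear_operator M1 M2 (\<lambda>_ _. 0)"
    unfolding linear_operator_def by (simp add: zero_in_L2)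
  show "\<exists>(r :: nat \<Rightarrow> nat) \<eta>. strict_mono r \<and> \<eta> \<in> L2 M2 \<and> (\<lambda>n. L2_norm M2 (\<lambda>y. 0 - \<eta> y)) \<longlonglongrightarrow> 0"
    by (rule exI[of _ "\<lambda>n. n"], rule exI[of _ "\<lambda>_. 0"])
      (simp add: zero_in_L2 L2_norm_def strict_mono_def)
qed

text \<open>
  The closure of the graph contains both \<open>(0, 0)\<close> and \<open>(0, T)\<close> with \<open>T\<close> the nonzero operator of the
  constant kernel.
\<close>

lemma not_closable_multiplier: "\<not> closable_multiplier M1 M2 \<phi>"
proof
  let ?G = "mult_graph M1 M2 \<phi>"
  let ?T = "integral_operator M1 (\<lambda>_. 1) :: ('a, 'b) operator"
  let ?Z = "(\<lambda>_ _. 0) :: ('a, 'b) operator"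
  have in_G: "(integral_operator M1 l, integral_operator M1 (\<lambda>p. \<phi> p * l p)) \<in> ?G"
    if "bounded_kernel M1 M2 l" "bounded_kernel M1 M2 (\<lambda>p. \<phi> p * l p)" for l
    using that unfolding mult_graph_def mult_domain_def by (auto intro: bounded_kernel_in_L2)
  have ZZ: "(?Z, ?Z) \<in> graph_closure M1 M2 ?G"
  proof -
    have "(?Z, ?Z) \<in> ?G"
      using in_G[of "\<lambda>_. 0"] by (simp add: bounded_kernel_const integral_operator_def)
    moreover have "op_norm M1 M2 (op_diff ?Z ?Z) \<le> 0"
      by (rule op_norm_le) (simp_all add: op_diff_def L2_norm_def)
    ultimately have "\<exists>(A, B)\<in>?G. op_norm M1 M2 (op_diff ?Z A) < \<epsilon> \<and> op_norm M1 M2 (op_diff ?Z B) < \<epsilon>"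
      if "0 < \<epsilon>" for \<epsilon>
      using that by (intro bexI[of _ "(?Z, ?Z)"]) auto
    then show ?thesis
      unfolding graph_closure_def using compact_operator_zero by blast
  qed
  have ZT: "(?Z, ?T) \<in> graph_closure M1 M2 ?G"
  proof -
    have "\<exists>(A, B)\<in>?G. op_norm M1 M2 (op_diff ?Z A) < \<epsilon> \<and> op_norm M1 M2 (op_diff ?T B) < \<epsilon>"
      if \<epsilon>: "0 < \<epsilon>" for \<epsilon>
    proof -
      have "eventually (\<lambda>n. a n < \<epsilon> \<and> b n < \<epsilon>) sequentially"
        using \<epsilon> a(2) b(2) by (intro eventually_conj order_tendstoD(2)[where y = 0]) auto
      then obtain n where n: "a n < \<epsilon>" "b n < \<epsilon>"
        by (auto simp: eventually_sequentially)
      let ?A = "integral_operator M1 (k n) :: ('a, 'b) operator"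
      let ?B = "integral_operator M1 (\<lambda>p. \<phi> p * k n p) :: ('a, 'b) operator"
      have "op_norm M1 M2 (op_diff ?Z ?A) \<le> a n"
      proof (rule op_norm_le)
        fix \<xi> assume "\<xi> \<in> L2 M1"
        then show "L2_norm M2 (op_diff ?Z ?A \<xi>) \<le> a n * L2_norm M1 \<xi>"
          using op_boundD[OF a(1)[of n]] by (simp add: op_diff_def L2_norm_def)
      qed (rule op_bound_nonneg[OF a(1)])
      moreover have "op_norm M1 M2 (op_diff ?T ?B) \<le> b n"
      proof (rule op_norm_le)
        fix \<xi> assume \<xi>: "\<xi> \<in> L2 M1"
        have "op_diff ?T ?B \<xi> y = integral_operator M1 (\<lambda>p. 1 - \<phi> p * k n p) \<xi> y"
          if y: "y \<in> space M2" for y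
          using bounded_kernel_section_integrable[OF \<phi>k[of n] \<xi> y] M1.L2_imp_integrable(1)[OF \<xi>]
          unfolding op_diff_def integral_operator_def by (simp add: left_diff_distrib)
        then show "L2_norm M2 (op_diff ?T ?B \<xi>) \<le> b n * L2_norm M1 \<xi>"
          using op_boundD[OF b(1)[of n] \<xi>] L2_norm_cong[of M2 "op_diff ?T ?B \<xi>"] by simp
      qed (rule op_bound_nonneg[OF b(1)])
      ultimately show ?thesis
        using n in_G[OF k[of n] \<phi>k[of n]] by (intro bexI[of _ "(?A, ?B)"]) auto
    qed
    then show ?thesis
      unfolding graph_closure_def using compact_operator_zero compact_operator_one by blast
  qed
  assume "closable_multiplier M1 M2 \<phi>"
  then have "op_eq M1 M2 ?Z ?Z \<longrightarrow> op_eq M1 M2 ?Z ?T"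
    using ZZ ZT unfolding closable_multiplier_def is_operator_graph_def by blast
  then have "op_eq M1 M2 ?Z ?T"
    unfolding op_eq_def by simp
  moreover have "(\<lambda>_. 1) \<in> L2 M1"
    by (rule M1.bounded_in_L2[where B = 1]) auto
  ultimately have "AE y in M2. (0::complex) = 1"
    unfolding op_eq_def integral_operator_def by (auto simp: M1.prob_space)
  then show False
    by simp
qed

end

section \<open>The marginal topology\<close>

lemma marginally_null_empty: "marginally_null M N {}"
  unfolding marginally_null_def by blast

lemma marginally_null_null_rectangle:
  assumes "\<alpha> \<in> sets M" "\<beta> \<in> sets N" and "\<alpha> \<in> null_sets M \<or> \<beta> \<in> null_sets N"
  shows "marginally_null M N (\<alpha> \<times> \<beta>)"
  using assms(3)
proof
  assume "\<alpha> \<in> null_sets M"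
  moreover have "\<alpha> \<times> \<beta> \<subseteq> \<alpha> \<times> space N \<union> space M \<times> {}"
    using sets.sets_into_space[OF assms(2)] by blast
  ultimately show ?thesis
    unfolding marginally_null_def by blast
next
  assume "\<beta> \<in> null_sets N"
  moreover have "\<alpha> \<times> \<beta> \<subseteq> {} \<times> space N \<union> space M \<times> \<beta>"
    using sets.sets_into_space[OF assms(1)] by blast
  ultimately show ?thesis
    unfolding marginally_null_def by blast
qed

text \<open>
  The empty union already satisfies the defining property of the \<open>\<omega>\<close>-union, which settles its
  existence; the union chosen by \<^const>\<open>omega_union\<close> is a countable union of marginally null sets.
\<close>

lemma marginally_null_omega_union:
  assumes null: "\<And>E. E \<in> \<E> \<Longrightarrow> marginally_null M N E"
  shows "marginally_null M N (omega_union M N \<E>)"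
proof -
  have "is_omega_union M N \<E> {}"
    unfolding is_omega_union_def marginally_contains_def using null
    by (auto intro!: exI[of _ "{}"])
  then have "is_omega_union M N \<E> (omega_union M N \<E>)"
    unfolding omega_union_def by (rule someI)
  then obtain \<F> where \<F>: "countable \<F>" "\<F> \<subseteq> \<E>" "omega_union M N \<E> = (\<Union>E\<in>\<F>. E)"
    unfolding is_omega_union_def by auto
  show ?thesis
    unfolding \<F>(3) by (rule marginally_null_UN[OF \<F>(1)]) (use \<F>(2) null in blast)
qed

text \<open>
  If no rectangle of positive measure is good, then the good rectangles are all marginally null and
  so is their \<open>\<omega>\<close>-union.
\<close>

lemma extremely_non_schurI:
  assumes "\<And>\<alpha> \<beta>. \<alpha> \<in> sets M \<Longrightarrow> \<beta> \<in> sets N \<Longrightarrow> \<alpha> \<notin> null_sets M \<Longrightarrow> \<beta> \<notin> null_sets N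
      \<Longrightarrow> \<not> schur_multiplier_on M N \<phi> \<alpha> \<beta>"
  shows "extremely_non_schur M N \<phi>"
proof -
  let ?\<E> = "{\<alpha> \<times> \<beta> | \<alpha> \<beta>. \<alpha> \<in> sets M \<and> \<beta> \<in> sets N \<and> schur_multiplier_on M N \<phi> \<alpha> \<beta>}"
  have "marginally_null M N (omega_union M N ?\<E>)"
  proof (rule marginally_null_omega_union)
    fix E assume "E \<in> ?\<E>"
    then obtain \<alpha> \<beta> where "E = \<alpha> \<times> \<beta>" "\<alpha> \<in> sets M" "\<beta> \<in> sets N" "schur_multiplier_on M N \<phi> \<alpha> \<beta>"
      by blast
    with assms[of \<alpha> \<beta>] show "marginally_null M N E"
      using marginally_null_null_rectangle by blast
  qed
  then show ?thesis
    unfolding extremely_non_schur_def marginally_equivalent_def kappa_def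
    by (rule marginally_null_subset) blast
qed

text \<open>
  Second countability makes every open subset of the product a countable union of open rectangles.
\<close>

lemma continuous_imp_omega_continuous:
  fixes M :: "'a::second_countable_topology measure" and N :: "'b::second_countable_topology measure"
  assumes M: "sets M = sets borel" and N: "sets N = sets borel" and g: "continuous_on UNIV g"
  shows "omega_continuous M N g"
proof -
  have "g \<in> borel_measurable (borel :: ('a \<times> 'b) measure)"
    by (rule borel_measurable_continuous_onI[OF g])
  moreover have "sets (M \<Otimes>\<^sub>M N) = sets (borel :: ('a \<times> 'b) measure)"
    unfolding borel_prod[symmetric] by (rule sets_pair_measure_cong[OF M N])
  ultimately have meas: "g \<in> borel_measurable (M \<Otimes>\<^sub>M N)"
    by (simp cong: measurable_cong_sets)
  have "omega_open M N (g -` U \<inter> (space M \<times> space N))" if U: "open U" for U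
  proof -
    have sp: "space M = UNIV" "space N = UNIV"
      using sets_eq_imp_space_eq[OF M] sets_eq_imp_space_eq[OF N] by auto
    have opn: "open (g -` U)"
      by (rule open_vimage[OF U g])
    obtain A :: "'a set set" where A: "countable A" "topological_basis A"
      using ex_countable_basis by blast
    obtain B :: "'b set set" where B: "countable B" "topological_basis B"
      using ex_countable_basis by blast
    define R where "R = {V \<in> (\<lambda>(a, b). a \<times> b) ` (A \<times> B). V \<subseteq> g -` U}"
    have "countable R"
      unfolding R_def
      by (rule countable_Collect[OF countable_image[OF countable_SIGMA[OF A(1) B(1)]]])
    moreover have "R \<subseteq> rectangles M N"
    proof
      fix V assume "V \<in> R"
      then obtain a b where ab: "V = a \<times> b" "a \<in> A" "b \<in> B"
        unfolding R_def by auto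
      have "a \<in> sets M" "b \<in> sets N"
        unfolding M N
        by (rule borel_open[OF topological_basis_open[OF A(2) ab(2)]],
            rule borel_open[OF topological_basis_open[OF B(2) ab(3)]])
      then show "V \<in> rectangles M N"
        unfolding rectangles_def ab(1) by blast
    qed
    moreover have "g -` U = \<Union>R"
    proof
      show "g -` U \<subseteq> \<Union>R"
      proof
        fix p assume p: "p \<in> g -` U"
        obtain V where V: "V \<in> (\<lambda>(a, b). a \<times> b) ` (A \<times> B)" "p \<in> V" "V \<subseteq> g -` U"
          by (rule topological_basisE[OF topological_basis_prod[OF A(2) B(2)] opn p])
        then show "p \<in> \<Union>R"
          unfolding R_def by blast
      qed
    qed (auto simp: R_def)
    ultimately show ?thesis
      unfolding omega_open_def sp marginally_equivalent_def
      by (intro exI[of _ R]) (simp add: marginally_null_empty)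
  qed
  then show ?thesis
    unfolding omega_continuous_def using meas by blast
qed

lemma standard_sigma_finite_borel:
  fixes M :: "'a::polish_space measure"
  assumes "sets M = sets borel" and "sigma_finite_measure M"
  shows "standard_sigma_finite M"
proof -
  obtain B :: "'a set set" where B: "countable B" "topological_basis B"
    using ex_countable_basis by blast
  have "second_countable (euclidean :: 'a topology)"
    unfolding second_countable_def
  proof (intro exI[of _ B] conjI allI impI ballI)
    fix U :: "'a set" and x assume "openin euclidean U \<and> x \<in> U"
    then have U: "open U" "x \<in> U"
      by simp_all
    obtain V where "V \<in> B" "x \<in> V" "V \<subseteq> U"
      by (rule topological_basisE[OF B(2) U])
    then show "\<exists>V\<in>B. x \<in> V \<and> V \<subseteq> U"
      by blast
  next
    fix V assume "V \<in> B"
    then show "openin euclidean V"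
      using topological_basis_open[OF B(2)] by simp
  qed (rule B(1))
  moreover have "completely_metrizable_space (euclidean :: 'a topology)"
    by (rule completely_metrizable_space_euclidean)
  moreover have "sets M = sigma_sets UNIV {U. open U}" "space M = UNIV"
    using sets_eq_imp_space_eq[OF assms(1)] assms(1) by (auto simp: sets_borel)
  ultimately show ?thesis
    unfolding standard_sigma_finite_def standard_borel_space_def using assms(2)
    by (intro conjI exI[of _ euclidean]) auto
qed

section \<open>Oscillating kernels\<close>

lemma (in pair_sigma_finite)
  fixes f :: "'a \<Rightarrow> 'c::{real_normed_field, banach, second_countable_topology}"
  assumes f: "integrable M1 f" and g: "integrable M2 g"
  shows integrable_tensor: "integrable (M1 \<Otimes>\<^sub>M M2) (\<lambda>p. f (fst p) * g (snd p))"
    and integral_tensor: "(\<integral>p. f (fst p) * g (snd p) \<partial>(M1 \<Otimes>\<^sub>M M2)) = (\<integral>x. f x \<partial>M1) * (\<integral>y. g y \<partial>M2)"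
proof -
  have [measurable]: "f \<in> borel_measurable M1" "g \<in> borel_measurable M2"
    using f g by auto
  show *: "integrable (M1 \<Otimes>\<^sub>M M2) (\<lambda>p. f (fst p) * g (snd p))"
  proof (rule Fubini_integrable)
    show "integrable M1 (\<lambda>x. \<integral>y. norm (f (fst (x, y)) * g (snd (x, y))) \<partial>M2)"
      using f by (simp add: norm_mult)
    show "AE x in M1. integrable M2 (\<lambda>y. f (fst (x, y)) * g (snd (x, y)))"
      using g by simp
  qed measurable
  show "(\<integral>p. f (fst p) * g (snd p) \<partial>(M1 \<Otimes>\<^sub>M M2)) = (\<integral>x. f x \<partial>M1) * (\<integral>y. g y \<partial>M2)"
    using integral_fst'[OF *] by simp
qed

text \<open>
  The Gaussian measure is convenient because its characteristic function is explicit and decays.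
\<close>

abbreviation gauss :: "real measure" where
  "gauss \<equiv> std_normal_distribution"

abbreviation wave :: "real \<Rightarrow> real \<times> real \<Rightarrow> complex" where
  "wave t \<equiv> \<lambda>p. cis (t * fst p * snd p)"

interpretation gauss: real_distribution gauss
  by (rule real_dist_normal_dist)

interpretation gauss2: pair_prob_space gauss gauss ..

lemma wave_bounded_kernel: "bounded_kernel gauss gauss (wave t)"
proof (rule bounded_kernelI)
  show "wave t \<in> borel_measurable (gauss \<Otimes>\<^sub>M gauss)"
    unfolding cis_conv_exp by measurable
  show "cmod (wave t p) \<le> 1" for p
    by simp
qed

lemma gauss_diagonal_null: "AE p in gauss \<Otimes>\<^sub>M gauss. fst p \<noteq> snd p"
proof (rule gauss2.AE_pair_measure)
  show "AE x in gauss. AE y in gauss. fst (x, y) \<noteq> snd (x, y)"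
  proof (rule AE_I2)
    fix x :: real
    have "AE y in lborel. y \<noteq> x"
      by (rule AE_lborel_singleton)
    then show "AE y in gauss. fst (x, y) \<noteq> snd (x, y)"
      by (subst AE_density) auto
  qed
qed measurable

text \<open>
  If \<open>T\<close> is the operator with kernel \<open>cis (t * x * y)\<close>, then this is the kernel, at the pair
  \<open>p = (x, x')\<close>, of \<open>T\<^sup>* T\<close>: the characteristic function of the Gaussian
  measure at \<open>t * (x - x')\<close>.
\<close>

definition dephasing :: "real \<Rightarrow> real \<times> real \<Rightarrow> complex" where
  "dephasing t p = of_real (exp (- ((t * (fst p - snd p))\<^sup>2) / 2))"

lemma dephasing_measurable [measurable]: "dephasing t \<in> borel_measurable (gauss \<Otimes>\<^sub>M gauss)"
  unfolding dephasing_def by measurable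

lemma norm_dephasing_le_1: "cmod (dephasing t p) \<le> 1"
  unfolding dephasing_def by (simp del: of_real_exp)

lemma gauss_integral_wave: "(\<integral>y. cis (s * y) \<partial>gauss) = of_real (exp (- (s\<^sup>2) / 2))"
  using fun_cong[OF char_std_normal_distribution, of s] unfolding char_def cis_conv_exp .

lemma dephasing_L2: "dephasing t \<in> L2 (gauss \<Otimes>\<^sub>M gauss)"
  by (rule gauss2.P.bounded_in_L2[OF dephasing_measurable norm_dephasing_le_1])

text \<open>
  Off the diagonal, which is a null set, the kernel tends to zero pointwise, so dominated
  convergence applies along integers; other values of \<open>t\<close> follow because the kernel decreases in
  \<open>\<bar>t\<bar>\<close>.
\<close>

lemma dephasing_vanishes:
  assumes "\<delta> > 0"
  shows "\<exists>R\<ge>0. \<forall>t. R \<le> \<bar>t\<bar> \<longrightarrow> L2_norm (gauss \<Otimes>\<^sub>M gauss) (dephasing t) \<le> \<delta>"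
proof -
  let ?P = "gauss \<Otimes>\<^sub>M gauss"
  have "(\<lambda>n. \<integral>p. (cmod (dephasing (real n) p))\<^sup>2 \<partial>?P) \<longlonglongrightarrow> (\<integral>p. 0 \<partial>?P)"
  proof (rule integral_dominated_convergence[where w = "\<lambda>_. 1"])
    show "AE p in ?P. (\<lambda>n. (cmod (dephasing (real n) p))\<^sup>2) \<longlonglongrightarrow> 0"
      using gauss_diagonal_null
    proof eventually_elim
      case (elim p)
      define c where "c = (fst p - snd p)\<^sup>2"
      have "c > 0"
        using elim by (simp add: c_def)
      then have "(\<lambda>n. (exp (- ((real n)\<^sup>2 * c) / 2))\<^sup>2) \<longlonglongrightarrow> 0"
        by real_asymp
      then show ?case
        by (simp add: dephasing_def c_def power_mult_distrib del: of_real_exp)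
    qed
    show "AE p in ?P. norm ((cmod (dephasing (real n) p))\<^sup>2) \<le> 1" for n
      using norm_dephasing_le_1 by (auto simp: power_le_one)
  qed auto
  then have "(\<lambda>n. L2_norm ?P (dephasing (real n))) \<longlonglongrightarrow> 0"
    unfolding L2_norm_def using tendsto_real_sqrt by fastforce
  then have "eventually (\<lambda>n. L2_norm ?P (dephasing (real n)) < \<delta>) sequentially"
    by (rule order_tendstoD(2)[OF _ assms])
  then obtain n where n: "L2_norm ?P (dephasing (real n)) < \<delta>"
    by (auto simp: eventually_sequentially)
  show ?thesis
  proof (intro exI[of _ "real n"] conjI allI impI)
    fix t :: real assume t: "real n \<le> \<bar>t\<bar>"
    have le: "(cmod (dephasing t p))\<^sup>2 \<le> (cmod (dephasing (real n) p))\<^sup>2" for p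
    proof -
      have "(real n)\<^sup>2 \<le> t\<^sup>2"
        using power_mono[OF t, of 2] by simp
      then have "(real n * (fst p - snd p))\<^sup>2 \<le> (t * (fst p - snd p))\<^sup>2"
        by (simp add: power_mult_distrib mult_right_mono)
      then show ?thesis
        unfolding dephasing_def by (intro power_mono) (simp_all del: of_real_exp)
    qed
    have "L2_norm ?P (dephasing t) \<le> L2_norm ?P (dephasing (real n))"
      unfolding L2_norm_def
      by (intro real_sqrt_le_mono integral_mono L2_integrable_power2[OF dephasing_L2] le)
    with n show "L2_norm ?P (dephasing t) \<le> \<delta>"
      by linarith
  qed simp
qed

text \<open>
  The operator norm of \<open>T\<^sup>* T\<close> is at most its Hilbert-Schmidt norm. The proof expands
  \<open>\<bar>T \<xi>\<bar>\<^sup>2\<close> as a double integral over \<open>x\<close> and \<open>x'\<close>, integrates over \<open>y\<close> first, and applies the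
  Cauchy-Schwarz inequality on the square.
\<close>

lemma wave_op_norm:
  assumes \<xi>: "\<xi> \<in> L2 gauss"
  shows "(L2_norm gauss (integral_operator gauss (wave t) \<xi>))\<^sup>2
    \<le> L2_norm (gauss \<Otimes>\<^sub>M gauss) (dephasing t) * (L2_norm gauss \<xi>)\<^sup>2"
proof -
  let ?P = "gauss \<Otimes>\<^sub>M gauss"
  interpret T: pair_prob_space ?P gauss ..
  have xm [measurable]: "\<xi> \<in> borel_measurable gauss"
    by (rule L2_measurable[OF \<xi>])
  have xint: "integrable gauss \<xi>"
    by (rule gauss.L2_imp_integrable(1)[OF \<xi>])
  define h where "h p = \<xi> (fst p) * cnj (\<xi> (snd p))" for p
  have hint: "integrable ?P h"
    unfolding h_def using xint by (intro gauss2.integrable_tensor) auto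
  then have hm [measurable]: "h \<in> borel_measurable ?P"
    by (rule borel_measurable_integrable)
  have hsq: "(cmod (h p))\<^sup>2 = (cmod (\<xi> (fst p)))\<^sup>2 * (cmod (\<xi> (snd p)))\<^sup>2" for p
    unfolding h_def by (simp add: norm_mult power_mult_distrib)
  have hL2: "h \<in> L2 ?P"
    unfolding L2_def using gauss2.integrable_tensor[OF L2_integrable_power2[OF \<xi>] L2_integrable_power2[OF \<xi>]]
    by (simp add: hsq)
  have hnorm: "L2_norm ?P h = (L2_norm gauss \<xi>)\<^sup>2"
  proof -
    have "(L2_norm ?P h)\<^sup>2 = ((L2_norm gauss \<xi>)\<^sup>2)\<^sup>2"
      unfolding L2_norm_power2 hsq
      using gauss2.integral_tensor[OF L2_integrable_power2[OF \<xi>] L2_integrable_power2[OF \<xi>]]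
      by (simp add: L2_norm_power2 power2_eq_square)
    then show ?thesis
      by (rule power2_eq_imp_eq) (simp_all add: L2_norm_nonneg)
  qed
  define g where "g p y = cis (t * (fst p - snd p) * y) * h p" for p y
  have gm: "case_prod g \<in> borel_measurable (?P \<Otimes>\<^sub>M gauss)"
  proof -
    have "(\<lambda>q. cis (t * (fst (fst q) - snd (fst q)) * snd q)) \<in> borel_measurable (?P \<Otimes>\<^sub>M gauss)"
      unfolding cis_conv_exp by measurable
    then have "(\<lambda>q. cis (t * (fst (fst q) - snd (fst q)) * snd q) * h (fst q)) \<in> borel_measurable (?P \<Otimes>\<^sub>M gauss)"
      by measurable
    then show ?thesis
      by (simp add: g_def case_prod_beta')
  qed
  have gint: "integrable (?P \<Otimes>\<^sub>M gauss) (case_prod g)"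
  proof (rule Bochner_Integration.integrable_bound)
    show "integrable (?P \<Otimes>\<^sub>M gauss) (\<lambda>q. h (fst q) * 1)"
      by (rule T.integrable_tensor[OF hint]) simp
    show "AE q in ?P \<Otimes>\<^sub>M gauss. norm (case_prod g q) \<le> norm (h (fst q) * 1)"
      by (simp add: g_def case_prod_beta' norm_mult)
  qed (rule gm)
  let ?F = "integral_operator gauss (wave t) \<xi>"
  have F: "of_real ((cmod (?F y))\<^sup>2) = (\<integral>p. g p y \<partial>?P)" for y
  proof -
    have int: "integrable gauss (\<lambda>x. cis (t * x * y) * \<xi> x)"
      using gauss2.bounded_kernel_section_integrable[OF wave_bounded_kernel \<xi>, of y] by simp
    have "of_real ((cmod (?F y))\<^sup>2) = ?F y * cnj (?F y)"
      by (rule complex_norm_square)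
    also have "\<dots> = (\<integral>x. cis (t * x * y) * \<xi> x \<partial>gauss) * (\<integral>x. cnj (cis (t * x * y) * \<xi> x) \<partial>gauss)"
      unfolding integral_operator_def by (simp only: Bochner_Integration.integral_cnj fst_conv snd_conv)
    also have "\<dots> = (\<integral>p. (cis (t * fst p * y) * \<xi> (fst p)) * cnj (cis (t * snd p * y) * \<xi> (snd p)) \<partial>?P)"
      by (rule gauss2.integral_tensor[OF int integrable_cnj[OF int], symmetric])
    also have "\<dots> = (\<integral>p. g p y \<partial>?P)"
    proof (rule Bochner_Integration.integral_cong[OF refl])
      fix p :: "real \<times> real"
      have "cis (t * fst p * y) * cnj (cis (t * snd p * y)) = cis (t * (fst p - snd p) * y)"
        by (simp add: cis_cnj cis_mult algebra_simps)
      then show "cis (t * fst p * y) * \<xi> (fst p) * cnj (cis (t * snd p * y) * \<xi> (snd p)) = g p y"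
        unfolding g_def h_def by (metis (no_types, opaque_lifting) complex_cnj_mult mult.assoc mult.left_commute)
    qed
    finally show ?thesis .
  qed
  have inner: "(\<integral>y. g p y \<partial>gauss) = dephasing t p * h p" for p
    using gauss_integral_wave[of "t * (fst p - snd p)"] by (simp add: g_def dephasing_def)
  have "of_real ((L2_norm gauss ?F)\<^sup>2) = (\<integral>y. complex_of_real ((cmod (?F y))\<^sup>2) \<partial>gauss)"
    unfolding L2_norm_power2 by (rule integral_complex_of_real[symmetric])
  also have "\<dots> = (\<integral>y. (\<integral>p. g p y \<partial>?P) \<partial>gauss)"
    unfolding F ..
  also have "\<dots> = (\<integral>p. (\<integral>y. g p y \<partial>gauss) \<partial>?P)"
    by (rule T.Fubini_integral[OF gint])
  also have "\<dots> = (\<integral>p. dephasing t p * h p \<partial>?P)"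
    unfolding inner ..
  finally have eq: "of_real ((L2_norm gauss ?F)\<^sup>2) = (\<integral>p. dephasing t p * h p \<partial>?P)" .
  have "(L2_norm gauss ?F)\<^sup>2 = cmod (of_real ((L2_norm gauss ?F)\<^sup>2))"
    by (simp add: norm_power L2_norm_nonneg)
  also have "\<dots> = cmod (\<integral>p. dephasing t p * h p \<partial>?P)"
    unfolding eq ..
  also have "\<dots> \<le> (\<integral>p. cmod (dephasing t p * h p) \<partial>?P)"
    by (rule integral_norm_bound)
  also have "\<dots> = (\<integral>p. cmod (dephasing t p) * cmod (h p) \<partial>?P)"
    by (simp add: norm_mult)
  also have "\<dots> \<le> L2_norm ?P (dephasing t) * L2_norm ?P h"
    by (rule L2_cauchy_schwarz(2)[OF dephasing_L2 hL2])
  finally show ?thesis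
    unfolding hnorm .
qed

lemma wave_op_bound_vanishes:
  assumes "\<delta> > 0"
  shows "\<exists>R\<ge>0. \<forall>t. R \<le> \<bar>t\<bar> \<longrightarrow> op_bound gauss gauss (wave t) \<delta>"
proof -
  have "\<delta>\<^sup>2 > 0"
    using assms by simp
  then obtain R where R: "R \<ge> 0" "\<And>t. R \<le> \<bar>t\<bar> \<Longrightarrow> L2_norm (gauss \<Otimes>\<^sub>M gauss) (dephasing t) \<le> \<delta>\<^sup>2"
    using dephasing_vanishes by blast
  have "op_bound gauss gauss (wave t) \<delta>" if t: "R \<le> \<bar>t\<bar>" for t
    unfolding op_bound_def
  proof
    fix \<xi> assume \<xi>: "\<xi> \<in> L2 gauss"
    have "(L2_norm gauss (integral_operator gauss (wave t) \<xi>))\<^sup>2 \<le> \<delta>\<^sup>2 * (L2_norm gauss \<xi>)\<^sup>2"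
      by (rule order_trans[OF wave_op_norm[OF \<xi>] mult_right_mono[OF R(2)[OF t]]]) simp
    then show "L2_norm gauss (integral_operator gauss (wave t) \<xi>) \<le> \<delta> * L2_norm gauss \<xi>"
      unfolding power_mult_distrib[symmetric]
      by (rule power2_le_imp_le) (use assms in \<open>simp add: L2_norm_nonneg\<close>)
  qed
  then show ?thesis
    using R(1) by blast
qed

section \<open>The lacunary series\<close>

text \<open>
  The coefficients \<open>1 / fact j\<close> are summable, so the sum is continuous, and each of them dominates
  the sum of all later ones by a factor tending to infinity.
\<close>

definition wave_series :: "(nat \<Rightarrow> real) \<Rightarrow> real \<times> real \<Rightarrow> complex" where
  "wave_series N p = (\<Sum>j. wave (N j) p / fact j)"

lemma summable_inverse_fact: "summable (\<lambda>j. 1 / fact j :: real)"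
  using summable_exp[of "1::real"] by (simp add: inverse_eq_divide)

lemma suminf_inverse_fact: "(\<Sum>j. 1 / fact j) = exp (1::real)"
  unfolding exp_def by (simp add: inverse_eq_divide)

lemma norm_wave_term: "cmod (wave t p / fact j) = 1 / fact j"
  by (simp add: norm_divide)

lemma summable_wave_series: "summable (\<lambda>j. wave (N j) p / fact j)"
  by (rule summable_norm_cancel) (simp only: norm_wave_term summable_inverse_fact)

lemma norm_wave_series: "cmod (wave_series N p) \<le> exp 1"
proof -
  have "cmod (wave_series N p) \<le> (\<Sum>j. cmod (wave (N j) p / fact j))"
    unfolding wave_series_def by (rule summable_norm) (simp only: norm_wave_term summable_inverse_fact)
  also have "\<dots> = exp 1"
    by (simp only: norm_wave_term suminf_inverse_fact)
  finally show ?thesis .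
qed

lemma continuous_wave_series: "continuous_on UNIV (wave_series N)"
proof (rule uniform_limit_theorem)
  show "uniform_limit UNIV (\<lambda>n p. \<Sum>j<n. wave (N j) p / fact j) (wave_series N) sequentially"
    unfolding wave_series_def
    by (rule Weierstrass_m_test[OF _ summable_inverse_fact]) (simp only: norm_wave_term order_refl)
  show "\<forall>\<^sub>F n in sequentially. continuous_on UNIV (\<lambda>p. \<Sum>j<n. wave (N j) p / fact j)"
    by (intro always_eventually allI continuous_intros) simp
qed simp

lemma bounded_kernel_wave_series: "bounded_kernel gauss gauss (wave_series N)"
proof (rule bounded_kernelI[OF _ norm_wave_series])
  have "omega_continuous gauss gauss (wave_series N)"
    by (rule continuous_imp_omega_continuous[OF _ _ continuous_wave_series]) simp_all
  then show "wave_series N \<in> borel_measurable (gauss \<Otimes>\<^sub>M gauss)"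
    unfolding omega_continuous_def by blast
qed

text \<open>
  Since \<open>fact i * fact (n + 1) \<le> fact (i + n + 1)\<close>, the tail is dominated by the exponential
  series divided by \<open>fact (n + 1)\<close>.
\<close>

lemma wave_series_tail:
  "cmod (fact n * (wave_series N p - (\<Sum>j<Suc n. wave (N j) p / fact j))) \<le> exp 1 / (real n + 1)"
proof -
  let ?t = "\<lambda>i. wave (N (i + Suc n)) p / fact (i + Suc n)"
  have tail: "wave_series N p - (\<Sum>j<Suc n. wave (N j) p / fact j) = (\<Sum>i. ?t i)"
    unfolding wave_series_def
    using suminf_split_initial_segment[OF summable_wave_series, of N p "Suc n"] by simp
  have le: "cmod (?t i) \<le> 1 / fact i * (1 / fact (Suc n))" for i
  proof -
    have "fact i * fact (Suc n) \<le> (fact (i + Suc n) :: nat)"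
      by (rule dvd_imp_le[OF fact_fact_dvd_fact]) simp
    then have "real (fact i * fact (Suc n)) \<le> real (fact (i + Suc n))"
      by (rule of_nat_mono)
    then have "fact i * fact (Suc n) \<le> (fact (i + Suc n) :: real)"
      by (simp only: of_nat_mult of_nat_fact)
    then show ?thesis
      unfolding norm_wave_term by (simp del: fact_Suc add_Suc_right add: divide_simps)
  qed
  have sm: "summable (\<lambda>i. 1 / fact i * (1 / fact (Suc n)) :: real)"
    by (rule summable_mult2[OF summable_inverse_fact])
  have "cmod (\<Sum>i. ?t i) \<le> (\<Sum>i. 1 / fact i * (1 / fact (Suc n)))"
    by (rule order_trans[OF summable_norm suminf_le[OF le _ sm]])
      (rule summable_comparison_test'[OF sm, of 0], use le in simp)+
  also have "\<dots> = exp 1 / fact (Suc n)"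
    using suminf_mult2[OF summable_inverse_fact, of "1 / fact (Suc n)", symmetric]
    by (simp only: suminf_inverse_fact) simp
  finally have "fact n * cmod (\<Sum>i. ?t i) \<le> fact n * (exp 1 / fact (Suc n))"
    by (rule mult_left_mono) simp
  also have "\<dots> = exp 1 / (real n + 1)"
    by (simp add: add.commute)
  finally show ?thesis
    unfolding tail by (simp add: norm_mult)
qed

text \<open>
  The growth condition on the frequencies is expressed by the smallness of the operators that it is
  meant to produce. In the bound, \<open>fact n\<close> cancels the factor by which the \<open>n\<close>-th kernel is scaled,
  and the square leaves room for adding up the \<open>n\<close> earlier frequencies.
\<close>

definition lacunary :: "(nat \<Rightarrow> real) \<Rightarrow> bool" where
  "lacunary N \<longleftrightarrow> (\<forall>n. op_bound gauss gauss (wave (- N n)) (1 / (fact n * (real n + 1)\<^sup>2)) \<and>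
     (\<forall>j<n. op_bound gauss gauss (wave (N j - N n)) (1 / (fact n * (real n + 1)\<^sup>2))))"

text \<open>
  Partial sums of the thresholds \<open>R n\<close> work: the distance from \<open>N n\<close> to zero and to every earlier
  frequency is at least the last summand \<open>R n\<close>.
\<close>

lemma ex_lacunary: "\<exists>N. lacunary N"
proof -
  let ?\<delta> = "\<lambda>n. 1 / (fact n * (real n + 1)\<^sup>2)"
  have "\<exists>R\<ge>0. \<forall>t. R \<le> \<bar>t\<bar> \<longrightarrow> op_bound gauss gauss (wave t) (?\<delta> n)" for n
    by (rule wave_op_bound_vanishes) simp
  then obtain R where R: "\<And>n. 0 \<le> R n" "\<And>n t. R n \<le> \<bar>t\<bar> \<Longrightarrow> op_bound gauss gauss (wave t) (?\<delta> n)"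
    by metis
  define N where "N n = (\<Sum>i\<le>n. R i)" for n
  have gap: "R n \<le> N n - (\<Sum>i\<in>A. R i)" if "A \<subseteq> {..<n}" for A n
  proof -
    have "(\<Sum>i\<in>A. R i) \<le> (\<Sum>i<n. R i)"
      using that R(1) by (intro sum_mono2) auto
    then show ?thesis
      unfolding N_def by (simp add: lessThan_Suc_atMost[symmetric])
  qed
  have "op_bound gauss gauss (wave (- N n)) (?\<delta> n)" for n
    using gap[of "{}" n] by (intro R(2)) simp
  moreover have "op_bound gauss gauss (wave (N j - N n)) (?\<delta> n)" if "j < n" for j n
  proof (rule R(2))
    have "{..j} \<subseteq> {..<n}"
      using that by auto
    then have "R n \<le> N n - N j"
      unfolding N_def[of j] by (rule gap)
    then show "R n \<le> \<bar>N j - N n\<bar>"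
      by linarith
  qed
  ultimately show ?thesis
    unfolding lacunary_def by blast
qed

text \<open>
  Multiplication by \<open>fact n * wave (- N n)\<close> turns the \<open>n\<close>-th term of the series into the constant
  \<open>1\<close>. The earlier terms keep oscillating and have small operators by the choice of the frequencies;
  the later terms are uniformly small by the choice of the coefficients.
\<close>

lemma collapsing_wave_series:
  assumes N: "lacunary N"
  shows "collapsing_kernels gauss gauss (wave_series N) (\<lambda>n p. fact n * wave (- N n) p)
    (\<lambda>n. 1 / (real n + 1)\<^sup>2) (\<lambda>n. real n / (real n + 1)\<^sup>2 + exp 1 / (real n + 1))"
proof
  fix n
  let ?\<delta> = "1 / (fact n * (real n + 1)\<^sup>2)"
  let ?k = "\<lambda>p. fact n * wave (- N n) p"
  have \<delta>: "op_bound gauss gauss (wave (- N n)) ?\<delta>" "\<And>j. j < n \<Longrightarrow> op_bound gauss gauss (wave (N j - N n)) ?\<delta>"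
    using N unfolding lacunary_def by blast+
  show k: "bounded_kernel gauss gauss ?k"
    by (intro bounded_kernel_mult bounded_kernel_const wave_bounded_kernel)
  show "bounded_kernel gauss gauss (\<lambda>p. wave_series N p * ?k p)"
    by (intro bounded_kernel_mult[OF bounded_kernel_wave_series k])
  show "op_bound gauss gauss ?k (1 / (real n + 1)\<^sup>2)"
    using op_bound_scale[OF \<delta>(1), of "fact n"] by simp
  (* products and sums with negated factors, so that the closure rules for bounded kernels apply *)
  let ?head = "\<lambda>p. \<Sum>j<n. - (fact n / fact j) * wave (N j - N n) p"
  let ?tail = "\<lambda>p. - 1 * ?k p * (wave_series N p + - 1 * (\<Sum>j<Suc n. 1 / fact j * wave (N j) p))"
  have tail_bk: "bounded_kernel gauss gauss ?tail"
    by (intro bounded_kernel_mult bounded_kernel_add bounded_kernel_sum bounded_kernel_const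
        wave_bounded_kernel bounded_kernel_wave_series)
  have head: "op_bound gauss gauss ?head (real n / (real n + 1)\<^sup>2)"
  proof (rule op_bound_mono)
    show "op_bound gauss gauss ?head (\<Sum>j<n. cmod (- (fact n / fact j)) * ?\<delta>)"
      by (intro gauss2.op_bound_sum op_bound_scale bounded_kernel_mult bounded_kernel_const
          wave_bounded_kernel \<delta>(2)) auto
    have "cmod (- (fact n / fact j)) * ?\<delta> \<le> 1 / (real n + 1)\<^sup>2" for j
    proof -
      have "cmod (- (fact n / fact j)) * ?\<delta> = 1 / fact j * (1 / (real n + 1)\<^sup>2)"
        by (simp add: norm_divide)
      also have "\<dots> \<le> 1 * (1 / (real n + 1)\<^sup>2)"
        by (rule mult_right_mono) (simp_all add: fact_ge_1)
      finally show ?thesis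
        by simp
    qed
    then have "(\<Sum>j<n. cmod (- (fact n / fact j)) * ?\<delta>) \<le> (\<Sum>j<n. 1 / (real n + 1)\<^sup>2)"
      by (intro sum_mono)
    then show "(\<Sum>j<n. cmod (- (fact n / fact j)) * ?\<delta>) \<le> real n / (real n + 1)\<^sup>2"
      by simp
  qed
  have tail: "op_bound gauss gauss ?tail (exp 1 / (real n + 1))"
  proof (rule gauss2.op_bound_sup)
    show "?tail \<in> borel_measurable (gauss \<Otimes>\<^sub>M gauss)"
      using tail_bk unfolding bounded_kernel_def by blast
    fix p
    have "cmod (?tail p) = cmod (fact n * (wave_series N p - (\<Sum>j<Suc n. wave (N j) p / fact j)))"
      by (simp add: norm_mult del: sum.lessThan_Suc)
    then show "cmod (?tail p) \<le> exp 1 / (real n + 1)"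
      using wave_series_tail[of n N p] by linarith
  qed
  have head_bk: "bounded_kernel gauss gauss ?head"
    by (intro bounded_kernel_sum bounded_kernel_mult bounded_kernel_const wave_bounded_kernel)
  have split: "(\<lambda>p. 1 - wave_series N p * ?k p) = (\<lambda>p. ?head p + ?tail p)"
  proof
    fix p
    have shift: "?k p * (1 / fact j * wave (N j) p) = (fact n / fact j) * wave (N j - N n) p" for j
      by (simp add: cis_mult algebra_simps)
    have "?k p * (\<Sum>j<Suc n. 1 / fact j * wave (N j) p) = (\<Sum>j<n. (fact n / fact j) * wave (N j - N n) p) + 1"
      unfolding sum_distrib_left shift by simp
    then show "1 - wave_series N p * ?k p = ?head p + ?tail p"
      by (simp add: sum_negf algebra_simps del: sum.lessThan_Suc)
  qed
  show "op_bound gauss gauss (\<lambda>p. 1 - wave_series N p * ?k p) (real n / (real n + 1)\<^sup>2 + exp 1 / (real n + 1))"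
    unfolding split by (rule gauss2.op_bound_add[OF head_bk head tail_bk tail])
next
  show "(\<lambda>n. 1 / (real n + 1)\<^sup>2) \<longlonglongrightarrow> 0"
    by real_asymp
  show "(\<lambda>n. real n / (real n + 1)\<^sup>2 + exp 1 / (real n + 1)) \<longlonglongrightarrow> 0"
    by real_asymp
qed

theorem proposition7p12:
  "\<exists>(M :: real measure) (N :: real measure) (\<phi> :: real \<times> real \<Rightarrow> complex).
     standard_sigma_finite M \<and> standard_sigma_finite N \<and>
     omega_continuous M N \<phi> \<and>
     \<not> closable_multiplier M N \<phi> \<and>
     extremely_non_schur M N \<phi>"
proof -
  obtain N where "lacunary N"
    using ex_lacunary by blast
  then interpret collapsing_kernels gauss gauss "wave_series N" "\<lambda>n p. fact n * wave (- N n) p"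
    "\<lambda>n. 1 / (real n + 1)\<^sup>2" "\<lambda>n. real n / (real n + 1)\<^sup>2 + exp 1 / (real n + 1)"
    by (rule collapsing_wave_series)
  have "standard_sigma_finite gauss"
    by (rule standard_sigma_finite_borel) (simp, unfold_locales)
  moreover have "omega_continuous gauss gauss (wave_series N)"
    by (rule continuous_imp_omega_continuous[OF _ _ continuous_wave_series]) simp_all
  moreover have "extremely_non_schur gauss gauss (wave_series N)"
  proof (rule extremely_non_schurI)
    fix \<alpha> \<beta> assume *: "\<alpha> \<in> sets gauss" "\<beta> \<in> sets gauss" "\<alpha> \<notin> null_sets gauss" "\<beta> \<notin> null_sets gauss"
    then have "measure gauss \<alpha> > 0" "measure gauss \<beta> > 0"
      by (auto simp: null_sets_def gauss.emeasure_eq_measure zero_less_measure_iff)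
    with * show "\<not> schur_multiplier_on gauss gauss (wave_series N) \<alpha> \<beta>"
      by (intro not_schur_multiplier_on)
  qed
  ultimately show ?thesis
    using not_closable_multiplier by blast
qed

end
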